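(* Let $\Gamma$ be a finite non-abelian group and set $\mathbb{G}=\widehat{\Gamma}$. Then there exists an orthogonal projection $P\in C(\mathbb{G})=\mathbb{C}[\Gamma]$ such that the quantum automorphism group of the quantum Cayley graph $(\mathbb{G},A_P)$, $A_P=P\star(\cdot)$, is equal to $\mathbb{G}$, i.e. the canonical surjection $\mathcal{O}(\operatorname{Qut}(\mathbb{G},A_P))\to\mathcal{O}(\mathbb{G})$ (intertwining the universal action with the comultiplication of $\mathbb{G}$) is an isomorphism of Hopf $*$-algebras.
   Context: $\widehat\Gamma$ is the finite quantum group with $C(\widehat\Gamma)=\mathbb{C}[\Gamma]$ (group algebra spanned by $\lambda_g$), $\Delta(\lambda_g)=\lambda_g\otimes\lambda_g$, antipode $S(\lambda_g)=\lambda_{g^{-1}}$, counit $\epsilon(\lambda_g)=1$. For a finite quantum group $\mathbb{G}$, $C(\mathbb{G})$ is regarded as a finite quantum set with $\psi$ the Haar functional normalized to be the tracial 1-form (the tracial positive functional with $mm^*=\mathrm{id}$ for the inner product $\langle x,y\rangle=\psi(x^*y)$). For $\omega\in C(\mathbb{G})^*$ put $L_\omega=(\omega\otimes\mathrm{id})\Delta$, $\psi_x(y)=\psi(xy)$, and define the convolution operator $x\star(\cdot)=L_{\psi_{S(x)}}$. For an orthogonal projection $P$, $A_P=P\star(\cdot)$ is a quantum adjacency matrix (the quantum Cayley graph of $P$). For a quantum graph $(\mathbb{X},A)$ (with $A\bullet A=A=\bar A$, where $A\bullet B=m(A\otimes B)m^*$, $\bar Af=(A(f^* ))^*$), $\operatorname{Qut}(\mathbb{X},A)$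 is the universal compact quantum group with a $\psi$-preserving action $\alpha$ on $C(\mathbb{X})$ satisfying $(A\otimes\mathrm{id})\alpha=\alpha A$; equivalently the universal $*$-algebra generated by entries of $U$ with $U$ unitary, $m(U\otimes U)=Um$, $U\eta=\eta$ ($\eta$ the unit), $UA=AU$. $\mathbb{G}$ acts on its quantum Cayley graphs via $\Delta$. *)

theory Defs
  imports "HOL-Algebra.Group" Complex_Main
begin

text \<open>The finite group Gamma is a HOL-Algebra group G whose carrier is the whole
finite type 'g.  An element of C[Gamma] is its coefficient function
x = (sum over g of x(g) lambda_g), i.e. a function 'g => complex.\<close>

definition cg_delta :: "'g \<Rightarrow> ('g \<Rightarrow> complex)" where
  "cg_delta a = (\<lambda>g. if g = a then 1 else 0)"

definition cg_zero :: "'g \<Rightarrow> complex" where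
  "cg_zero = (\<lambda>g. 0)"

definition cg_one :: "('g, 'm) monoid_scheme \<Rightarrow> ('g \<Rightarrow> complex)" where
  "cg_one G = cg_delta \<one>\<^bsub>G\<^esub>"

definition cg_mult :: "('g::finite, 'm) monoid_scheme \<Rightarrow> ('g \<Rightarrow> complex) \<Rightarrow> ('g \<Rightarrow> complex) \<Rightarrow> ('g \<Rightarrow> complex)" where
  "cg_mult G x y = (\<lambda>g. \<Sum>h\<in>UNIV. x h * y (inv\<^bsub>G\<^esub> h \<otimes>\<^bsub>G\<^esub> g))"
  \<comment> \<open>convolution: lambda_a lambda_b = lambda_(ab)\<close>

definition cg_star :: "('g, 'm) monoid_scheme \<Rightarrow> ('g \<Rightarrow> complex) \<Rightarrow> ('g \<Rightarrow> complex)" where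
  "cg_star G x = (\<lambda>g. cnj (x (inv\<^bsub>G\<^esub> g)))"   \<comment> \<open>lambda_g^* = lambda_(g^-1)\<close>

definition cg_antipode :: "('g, 'm) monoid_scheme \<Rightarrow> ('g \<Rightarrow> complex) \<Rightarrow> ('g \<Rightarrow> complex)" where
  "cg_antipode G x = (\<lambda>g. x (inv\<^bsub>G\<^esub> g))"   \<comment> \<open>S(lambda_g) = lambda_(g^-1), linear\<close>

text \<open>Haar functional normalised as the tracial 1-form (m m^* = id):
psi(lambda_g) = |Gamma| * delta_(g,e).\<close>
definition cg_psi :: "('g::finite, 'm) monoid_scheme \<Rightarrow> ('g \<Rightarrow> complex) \<Rightarrow> complex" where
  "cg_psi G x = of_nat (card (UNIV :: 'g set)) * x \<one>\<^bsub>G\<^esub>"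

text \<open>L_omega = (omega (x) id) Delta; since Delta(lambda_g) = lambda_g (x) lambda_g and Delta is
linear, L_omega(y) = sum_g y(g) omega(lambda_g) lambda_g.\<close>
definition cg_L :: "(('g \<Rightarrow> complex) \<Rightarrow> complex) \<Rightarrow> ('g \<Rightarrow> complex) \<Rightarrow> ('g \<Rightarrow> complex)" where
  "cg_L \<omega> y = (\<lambda>g. \<omega> (cg_delta g) * y g)"

text \<open>x star (.) = L_(psi_(S x)) with psi_x(y) = psi(x y).\<close>
definition cg_conv :: "('g::finite, 'm) monoid_scheme \<Rightarrow> ('g \<Rightarrow> complex) \<Rightarrow> ('g \<Rightarrow> complex) \<Rightarrow> ('g \<Rightarrow> complex)" where
  "cg_conv G x = cg_L (\<lambda>y. cg_psi G (cg_mult G (cg_antipode G x) y))"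

definition orth_proj :: "('g::finite, 'm) monoid_scheme \<Rightarrow> ('g \<Rightarrow> complex) \<Rightarrow> bool" where
  "orth_proj G P \<longleftrightarrow> cg_star G P = P \<and> cg_mult G P P = P"

text \<open>Generator (g,h,False) is u_(g,h), generator (g,h,True) is u_(g,h)^*.
An element of the free *-algebra is a finitely supported function from words
(noncommutative monomials) to complex coefficients.\<close>

type_synonym 'g gen = "'g \<times> 'g \<times> bool"
type_synonym 'g fa = "'g gen list \<Rightarrow> complex"

definition fa_fin :: "'g fa \<Rightarrow> bool" where
  "fa_fin f \<longleftrightarrow> finite {w. f w \<noteq> 0}"

definition fa_gen :: "'g gen \<Rightarrow> 'g fa" where
  "fa_gen x = (\<lambda>w. if w = [x] then 1 else 0)"

definition fa_const :: "complex \<Rightarrow> 'g fa" where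
  "fa_const c = (\<lambda>w. if w = [] then c else 0)"

definition fa_add :: "'g fa \<Rightarrow> 'g fa \<Rightarrow> 'g fa" where
  "fa_add f k = (\<lambda>w. f w + k w)"

definition fa_diff :: "'g fa \<Rightarrow> 'g fa \<Rightarrow> 'g fa" where
  "fa_diff f k = (\<lambda>w. f w - k w)"

definition fa_smul :: "complex \<Rightarrow> 'g fa \<Rightarrow> 'g fa" where
  "fa_smul c f = (\<lambda>w. c * f w)"

definition fa_sum :: "'i set \<Rightarrow> ('i \<Rightarrow> 'g fa) \<Rightarrow> 'g fa" where
  "fa_sum I F = (\<lambda>w. \<Sum>i\<in>I. F i w)"

definition fa_mult :: "'g fa \<Rightarrow> 'g fa \<Rightarrow> 'g fa" where
  "fa_mult f k = (\<lambda>w. \<Sum>i\<le>length w. f (take i w) * k (drop i w))"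

definition gen_flip :: "'g gen \<Rightarrow> 'g gen" where
  "gen_flip x = (case x of (g, h, b) \<Rightarrow> (g, h, \<not> b))"

definition fa_star :: "'g fa \<Rightarrow> 'g fa" where
  "fa_star f = (\<lambda>w. cnj (f (rev (map gen_flip w))))"

abbreviation u :: "'g \<Rightarrow> 'g \<Rightarrow> 'g fa" where
  "u g h \<equiv> fa_gen (g, h, False)"

abbreviation ustar :: "'g \<Rightarrow> 'g \<Rightarrow> 'g fa" where
  "ustar g h \<equiv> fa_gen (g, h, True)"

inductive_set fa_ideal :: "'g fa set \<Rightarrow> 'g fa set" for R where
  zero: "(\<lambda>w. 0) \<in> fa_ideal R"
| gen: "r \<in> R \<Longrightarrow> fa_fin a \<Longrightarrow> fa_fin b \<Longrightarrow> fa_mult (fa_mult a r) b \<in> fa_ideal R"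
| gen_star: "r \<in> R \<Longrightarrow> fa_fin a \<Longrightarrow> fa_fin b \<Longrightarrow> fa_mult (fa_mult a (fa_star r)) b \<in> fa_ideal R"
| add: "x \<in> fa_ideal R \<Longrightarrow> y \<in> fa_ideal R \<Longrightarrow> fa_add x y \<in> fa_ideal R"

text \<open>U is written in the basis (lambda_g), which is orthogonal with all norms equal for
<x,y> = psi(x^* y); U(lambda_h) = sum_g lambda_g (x) u_(g,h).  Each relation below is
an element of the free *-algebra required to be zero.  A is any linear map on C[Gamma].\<close>

definition qut_relations :: "('g::finite, 'm) monoid_scheme \<Rightarrow> (('g \<Rightarrow> complex) \<Rightarrow> ('g \<Rightarrow> complex)) \<Rightarrow> 'g fa set" where
  "qut_relations G A =
     \<comment> \<open>U^* U = 1\<close>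
     {fa_diff (fa_sum UNIV (\<lambda>k. fa_mult (ustar k g) (u k h))) (fa_const (if g = h then 1 else 0)) | g h. True}
   \<union> \<comment> \<open>U U^* = 1\<close>
     {fa_diff (fa_sum UNIV (\<lambda>k. fa_mult (u g k) (ustar h k))) (fa_const (if g = h then 1 else 0)) | g h. True}
   \<union> \<comment> \<open>m (U (x) U) = U m, tested on lambda_a (x) lambda_b, coefficient of lambda_g\<close>
     {fa_diff
        (fa_sum UNIV (\<lambda>c. fa_sum UNIV (\<lambda>d.
            fa_smul (cg_mult G (cg_delta c) (cg_delta d) g) (fa_mult (u c a) (u d b)))))
        (fa_sum UNIV (\<lambda>k. fa_smul (cg_mult G (cg_delta a) (cg_delta b) k) (u g k))) | a b g. True}
   \<union> \<comment> \<open>U eta = eta, coefficient of lambda_g\<close>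
     {fa_diff (fa_sum UNIV (\<lambda>h. fa_smul (cg_one G h) (u g h))) (fa_const (cg_one G g)) | g. True}
   \<union> \<comment> \<open>U A = A U, tested on lambda_h, coefficient of lambda_g\<close>
     {fa_diff (fa_sum UNIV (\<lambda>k. fa_smul (A (cg_delta h) k) (u g k)))
              (fa_sum UNIV (\<lambda>k. fa_smul (A (cg_delta k) g) (u k h))) | g h. True}"

text \<open>The action of G on itself is Delta: Delta(lambda_h) = lambda_h (x) lambda_h
= sum_g lambda_g (x) u_(g,h), so u_(g,h) is sent to delta_(g,h) lambda_h.\<close>
definition delta_coef :: "'g \<Rightarrow> 'g \<Rightarrow> ('g \<Rightarrow> complex)" where
  "delta_coef g h = (if g = h then cg_delta h else cg_zero)"

definition gen_img :: "('g, 'm) monoid_scheme \<Rightarrow> 'g gen \<Rightarrow> ('g \<Rightarrow> complex)" where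
  "gen_img G x = (case x of (g, h, b) \<Rightarrow> if b then cg_star G (delta_coef g h) else delta_coef g h)"

fun word_img :: "('g::finite, 'm) monoid_scheme \<Rightarrow> 'g gen list \<Rightarrow> ('g \<Rightarrow> complex)" where
  "word_img G [] = cg_one G"
| "word_img G (x # w) = cg_mult G (gen_img G x) (word_img G w)"

definition fa_eval :: "('g::finite, 'm) monoid_scheme \<Rightarrow> 'g fa \<Rightarrow> ('g \<Rightarrow> complex)" where
  "fa_eval G f = (\<lambda>g. \<Sum>w\<in>{w. f w \<noteq> 0}. f w * word_img G w g)"

text \<open>The canonical surjection O(Qut(G,A)) = Free/I -> O(G) is an isomorphism iff the
kernel of fa_eval equals the *-ideal generated by the defining relations.\<close>
definition qut_is_G :: "('g::finite, 'm) monoid_scheme \<Rightarrow> (('g \<Rightarrow> complex) \<Rightarrow> ('g \<Rightarrow> complex)) \<Rightarrow> bool" where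
  "qut_is_G G A \<longleftrightarrow> {f. fa_fin f \<and> fa_eval G f = cg_zero} = fa_ideal (qut_relations G A)"

end

theory Submission
  imports Defs "HOL-Algebra.Multiplicative_Group" "HOL-Analysis.Analysis"
begin

text \<open>
  The operator \<open>A\<^sub>P\<close> is diagonal: it multiplies \<open>\<lambda>\<^sub>h\<close> by \<open>|\<Gamma>| P(h)\<close>.  Hence \<open>u\<^sub>g\<^sub>h = 0\<close> in the quantum
  automorphism group as soon as \<open>P(g) \<noteq> P(h)\<close>.  If \<open>P\<close> separates every noncentral element from all other
  elements, then \<open>u\<^sub>g\<^sub>h = 0\<close> for all \<open>g \<noteq> h\<close>, because a central element is a product of two noncentral
  ones; so \<open>U\<close> is diagonal with multiplicative entries, and these satisfy the relations of \<open>\<complex>[\<Gamma>]\<close>.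

  To find \<open>P\<close>, take first a projection which is nonscalar in every noncommutative block of \<open>\<complex>[\<Gamma>]\<close>, and
  among these one for which the number of separated pairs is maximal.  If \<open>\<phi>(y) = \<tau>(x y)\<close> vanishes at
  \<open>P\<close>, where \<open>x = \<lambda>\<^sub>g\<^sup>* - \<lambda>\<^sub>h\<^sup>*\<close>, then by maximality it vanishes at all small unitary perturbations of \<open>P\<close>, and
  second-order differentiation gives \<open>\<phi>([a,[b,P]]) = 0\<close> for all \<open>a\<close>, \<open>b\<close>.  Thus \<open>P\<close> commutes with every
  \<open>[x,a]\<close>, which for such a \<open>P\<close> forces \<open>x\<close>, and therefore \<open>g\<close> and \<open>h\<close>, to be central.
\<close>

section \<open>Separating projections in tracial algebras\<close>

text \<open>The last axiom is the only place where finite-dimensionality enters.\<close>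

class tracial_star_algebra = ring_1 +
  fixes smul :: "complex \<Rightarrow> 'a \<Rightarrow> 'a"
    and star :: "'a \<Rightarrow> 'a"
    and tau :: "'a \<Rightarrow> complex"
  assumes smul_add_right: "smul c (x + y) = smul c x + smul c y"
    and smul_add_left: "smul (c + d) x = smul c x + smul d x"
    and smul_smul: "smul c (smul d x) = smul (c * d) x"
    and smul_one: "smul 1 x = x"
    and mult_smul_left: "smul c x * y = smul c (x * y)"
    and mult_smul_right: "x * smul c y = smul c (x * y)"
    and star_star: "star (star x) = x"
    and star_add: "star (x + y) = star x + star y"
    and star_mult: "star (x * y) = star y * star x"
    and star_smul: "star (smul c x) = smul (cnj c) (star x)"
    and tau_add: "tau (x + y) = tau x + tau y"
    and tau_smul: "tau (smul c x) = c * tau x"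
    and tau_commute: "tau (x * y) = tau (y * x)"
    and tau_faithful: "tau (star x * x) = 0 \<Longrightarrow> x = 0"
    and orthogonal_component:
      "\<lbrakk>0 \<in> V; \<And>x y. x \<in> V \<Longrightarrow> y \<in> V \<Longrightarrow> x + y \<in> V; \<And>c x. x \<in> V \<Longrightarrow> smul c x \<in> V\<rbrakk>
        \<Longrightarrow> \<exists>f\<in>V. \<forall>y\<in>V. tau (star y * (x - f)) = 0"
begin

lemma smul_zero_right: "smul c 0 = 0"
  using smul_add_right[of c 0 0] by simp

lemma smul_zero_left: "smul 0 x = 0"
  using smul_add_left[of 0 0 x] by simp

lemma smul_minus_one: "smul (- 1) x = - x"
proof -
  have "smul (- 1) x + x = smul (- 1 + 1) x"
    by (subst smul_add_left) (simp add: smul_one)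
  then show ?thesis by (simp add: smul_zero_left eq_neg_iff_add_eq_0)
qed

lemma smul_minus_right: "smul c (- x) = - smul c x"
  by (simp add: smul_smul flip: smul_minus_one)

lemma smul_minus_left: "smul (- c) x = - smul c x"
  by (simp add: smul_smul flip: smul_minus_one)

lemma smul_diff_right: "smul c (x - y) = smul c x - smul c y"
  by (simp add: diff_conv_add_uminus smul_add_right smul_minus_right del: add_uminus_conv_diff)

lemma smul_diff_left: "smul (c - d) x = smul c x - smul d x"
  using smul_add_left[of c "- d" x] by (simp add: smul_minus_left)

lemma star_zero: "star 0 = 0"
  using star_add[of 0 0] by simp

lemma star_minus: "star (- x) = - star x"
  by (simp add: star_smul flip: smul_minus_one)

lemma star_diff: "star (x - y) = star x - star y"
  by (simp add: diff_conv_add_uminus star_add star_minus del: add_uminus_conv_diff)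

lemma star_one: "star 1 = 1"
  using star_mult[of "star 1" 1] by (simp add: star_star)

lemma tau_zero: "tau 0 = 0"
  using tau_add[of 0 0] by simp

lemma tau_minus: "tau (- x) = - tau x"
  by (simp add: tau_smul flip: smul_minus_one)

lemma tau_diff: "tau (x - y) = tau x - tau y"
  by (simp add: diff_conv_add_uminus tau_add tau_minus del: add_uminus_conv_diff)

lemma star_mult_eq_0: "star x * x = 0 \<Longrightarrow> x = 0"
  using tau_faithful tau_zero by metis

text \<open>Nondegeneracy of the trace pairing, from the choice \<open>b = star x\<close>.\<close>

lemma eq_0_if_tau_orthogonal: "(\<And>b. tau (b * x) = 0) \<Longrightarrow> x = 0"
  using tau_faithful by blast

section \<open>Commutators and the ideals they annihilate\<close>

definition csubspace :: "'a set \<Rightarrow> bool" where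
  "csubspace V \<longleftrightarrow> 0 \<in> V \<and> (\<forall>x\<in>V. \<forall>y\<in>V. x + y \<in> V) \<and> (\<forall>c. \<forall>x\<in>V. smul c x \<in> V)"

definition projection :: "'a \<Rightarrow> bool" where
  "projection p \<longleftrightarrow> star p = p \<and> p * p = p"

definition comm :: "'a \<Rightarrow> 'a \<Rightarrow> 'a" where
  "comm x y = x * y - y * x"

text \<open>The free middle factor \<open>c\<close> makes this the annihilator of the two-sided
  ideal generated by all \<open>comm p a\<close>, hence itself a two-sided ideal.\<close>

definition comm_annihilator :: "'a \<Rightarrow> 'a set" where
  "comm_annihilator p = {y. \<forall>a c. comm p a * c * y = 0}"

lemma star_comm: "star (comm x y) = comm (star y) (star x)"
  by (simp add: comm_def star_diff star_mult)

lemma csubspace_comm_annihilator: "csubspace (comm_annihilator p)"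
  by (auto simp: csubspace_def comm_annihilator_def distrib_left mult_smul_right smul_zero_right)

lemma comm_annihilator_mult_left: "y \<in> comm_annihilator p \<Longrightarrow> a * y \<in> comm_annihilator p"
  unfolding comm_annihilator_def
proof (intro CollectI allI)
  fix b c assume "y \<in> {y. \<forall>a c. comm p a * c * y = 0}"
  then have "comm p b * (c * a) * y = 0" by blast
  then show "comm p b * c * (a * y) = 0" by (simp add: mult.assoc)
qed

lemma comm_annihilator_mult_right: "y \<in> comm_annihilator p \<Longrightarrow> y * a \<in> comm_annihilator p"
  by (simp add: comm_annihilator_def flip: mult.assoc)

text \<open>Here \<open>f\<close> is the orthogonal projection of 1 onto the ideal \<open>V\<close>.\<close>

lemma ideal_unit:
  assumes V: "csubspace V"
    and left: "\<And>a y. y \<in> V \<Longrightarrow> a * y \<in> V" and right: "\<And>a y. y \<in> V \<Longrightarrow> y * a \<in> V"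
    and f: "f \<in> V" "\<And>y. y \<in> V \<Longrightarrow> tau (star y * (1 - f)) = 0"
  shows "star f = f" "\<And>y. y \<in> V \<Longrightarrow> y * f = y" "\<And>y. y \<in> V \<Longrightarrow> f * y = y"
    "\<And>a. f * a = a * f"
proof -
  have yf: "y * (1 - f) = 0" if "y \<in> V" for y
  proof (rule tau_faithful)
    \<comment> \<open>The test vector \<open>star y * y * (1 - f)\<close> lies in \<open>V\<close>,
      and its pairing with \<open>1 - f\<close> is the squared norm of
      \<open>y * (1 - f)\<close>.\<close>
    have "tau (star (star y * y * (1 - f)) * (1 - f)) = 0"
      using that by (intro f(2) left right)
    then show "tau (star (y * (1 - f)) * (y * (1 - f))) = 0"
      by (simp add: star_mult star_star mult.assoc)
  qed
  have fy': "(1 - f) * y = 0" if "y \<in> V" for y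
  proof (rule tau_faithful)
    have "tau (star ((1 - f) * y * star y) * (1 - f)) = 0"
      using that by (intro f(2) left right)
    moreover have "tau (star ((1 - f) * y) * ((1 - f) * y)) = tau (y * (star ((1 - f) * y) * (1 - f)))"
      using tau_commute[of "star ((1 - f) * y) * (1 - f)" y] by (simp add: mult.assoc)
    ultimately show "tau (star ((1 - f) * y) * ((1 - f) * y)) = 0"
      by (simp add: star_mult star_star mult.assoc)
  qed
  show yf': "y * f = y" if "y \<in> V" for y
    using yf[OF that] by (simp add: right_diff_distrib)
  show fy: "f * y = y" if "y \<in> V" for y
    using fy'[OF that] by (simp add: left_diff_distrib)
  \<comment> \<open>Membership of \<open>star f\<close> in \<open>V\<close> is not yet known, so the
    test vector is built with \<open>f\<close> as its left factor.\<close>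
  have "star f * (1 - f) = 0"
  proof (rule tau_faithful)
    have "tau (star (f * star f * (1 - f)) * (1 - f)) = 0"
      using f(1) by (intro f(2) left right)
    then show "tau (star (star f * (1 - f)) * (star f * (1 - f))) = 0"
      by (simp add: star_mult star_star mult.assoc)
  qed
  then have ff: "star f * f = star f"
    by (simp add: right_diff_distrib)
  have "f = star (star f * f)"
    by (simp add: ff star_star)
  also have "\<dots> = star f * f"
    by (simp add: star_mult star_star)
  finally show "star f = f"
    by (simp add: ff)
  show "f * a = a * f" for a
    using yf'[OF right[OF f(1), of a]] fy[OF left[OF f(1), of a]] by (simp add: mult.assoc)
qed

lemma comm_mult_right: "comm p (a * b) = comm p a * b + a * comm p b"
  by (simp add: comm_def algebra_simps)

text \<open>The ideal \<open>comm_annihilator p\<close> consists of the matrix blocks in which \<open>p\<close> is scalar; \<open>r\<close> agrees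
  with \<open>q\<close> on these blocks and with \<open>p\<close> on the others.\<close>

lemma comm_annihilator_patch:
  assumes p: "projection p" and q: "projection q"
  obtains r where "projection r" "comm_annihilator r \<subseteq> comm_annihilator p"
    "comm_annihilator r \<subseteq> comm_annihilator q"
proof -
  let ?V = "comm_annihilator p"
  obtain f where f: "f \<in> ?V" "\<And>y. y \<in> ?V \<Longrightarrow> tau (star y * (1 - f)) = 0"
    using orthogonal_component[of ?V 1] csubspace_comm_annihilator[of p]
    unfolding csubspace_def by auto
  note unit = ideal_unit[OF csubspace_comm_annihilator comm_annihilator_mult_left
      comm_annihilator_mult_right f]
  have sf: "star f = f" and ff: "f * f = f" and fc: "\<And>a. f * a = a * f"
    and fy: "\<And>y. y \<in> ?V \<Longrightarrow> f * y = y"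
    using unit f(1) by blast+
  have fc': "a * (f * b) = f * (a * b)" for a b
    using fc[of a] by (simp flip: mult.assoc)
  have fff: "f * (f * a) = f * a" for a
    by (simp add: ff flip: mult.assoc)
  have pp: "star p = p" "p * p = p" "p * (p * a) = p * a"
    and qq: "star q = q" "q * q = q" "q * (q * a) = q * a" for a
    using p q by (simp_all add: projection_def flip: mult.assoc)
  define r where "r = p - f * p + f * q"
  have r: "projection r"
    unfolding projection_def r_def
    by (simp add: star_add star_diff star_mult sf pp qq distrib_left distrib_right
        left_diff_distrib right_diff_distrib mult.assoc fc[symmetric, of p] fc[symmetric, of q]
        fc'[of p] fc'[of q] fff ff)
  have fr: "f * comm r a = f * comm q a" for a
    unfolding comm_def r_def
    by (simp add: distrib_left distrib_right left_diff_distrib right_diff_distrib mult.assoc fc'[of a] fff ff)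
  have fp: "comm p a * f = 0" for a
  proof -
    have "comm p a * 1 * f = 0" using f(1) unfolding comm_annihilator_def by blast
    then show ?thesis by simp
  qed
  \<comment> \<open>As \<open>f\<close> is central and the commutators of \<open>p\<close> kill it,
    removing \<open>f * p\<close> from \<open>p\<close> does not change them.\<close>
  have pr: "comm r a = comm p a + f * comm q a" for a
  proof -
    have "f * comm p a = 0" by (simp only: fc[of "comm p a"] fp)
    moreover have "comm r a = comm p a - f * comm p a + f * comm q a"
      unfolding comm_def r_def
      by (simp add: distrib_left distrib_right left_diff_distrib right_diff_distrib mult.assoc fc'[of a]
          algebra_simps)
    ultimately show ?thesis by simp
  qed
  have "y \<in> ?V \<and> y \<in> comm_annihilator q" if y: "y \<in> comm_annihilator r" for y
  proof -
    have ry: "comm r a * c * y = 0" for a c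
      using y by (simp add: comm_annihilator_def)
    have qy: "f * (comm q a * c * y) = 0" for a c
    proof -
      have "f * (comm q a * c * y) = (f * comm r a) * c * y" by (simp add: fr mult.assoc)
      then show ?thesis using ry[of a c] by (simp add: mult.assoc)
    qed
    have py: "comm p a * c * y = 0" for a c
    proof -
      have "comm r a * c * y = comm p a * c * y + f * (comm q a * c * y)"
        by (simp add: pr distrib_right mult.assoc)
      then show ?thesis using ry[of a c] qy[of a c] by simp
    qed
    then have yV: "y \<in> ?V" by (simp add: comm_annihilator_def)
    have "comm q a * c * y = 0" for a c
    proof -
      have "comm q a * c * y = comm q a * c * (f * y)" using fy[OF yV] by simp
      also have "\<dots> = f * (comm q a * c * y)" by (rule fc')
      finally show ?thesis using qy by simp
    qed
    with yV show ?thesis by (simp add: comm_annihilator_def)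
  qed
  then show thesis using that[OF r] by blast
qed

text \<open>Patching in the members of \<open>Q\<close> one by one yields a projection that is
  nonscalar in every block where some member is nonscalar.\<close>

lemma ex_projection_comm_annihilator:
  assumes "finite Q" "\<forall>q\<in>Q. projection q"
  shows "\<exists>p. projection p \<and> (\<forall>q\<in>Q. comm_annihilator p \<subseteq> comm_annihilator q)"
  using assms
proof (induction Q)
  case empty
  have "projection 0" by (simp add: projection_def star_zero)
  then show ?case by blast
next
  case (insert q Q)
  then obtain p where p: "projection p" "\<forall>q\<in>Q. comm_annihilator p \<subseteq> comm_annihilator q" by auto
  obtain r where "projection r" "comm_annihilator r \<subseteq> comm_annihilator p"
    "comm_annihilator r \<subseteq> comm_annihilator q"
    using comm_annihilator_patch[OF p(1), of q] insert.prems by auto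
  with p(2) show ?case by (intro exI[of _ r]) blast
qed

section \<open>Spanning sets and a criterion for centrality\<close>

definition spanning :: "'a set \<Rightarrow> bool" where
  "spanning Q \<longleftrightarrow> (\<forall>V. csubspace V \<longrightarrow> Q \<subseteq> V \<longrightarrow> V = UNIV)"

text \<open>The sum of the commutative blocks. Thus
  \<open>comm_annihilator p \<subseteq> full_annihilator\<close> says that \<open>p\<close> is
  nonscalar in every noncommutative block.\<close>

definition full_annihilator :: "'a set" where
  "full_annihilator = {y. \<forall>a b c. comm a b * c * y = 0}"

text \<open>For fixed \<open>y\<close> the elements whose commutators annihilate \<open>y\<close> in
  this sense form a subspace, so testing on \<open>Q\<close> is enough.\<close>

lemma spanning_comm_annihilator:
  assumes "spanning Q" "\<And>q. q \<in> Q \<Longrightarrow> y \<in> comm_annihilator q"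
  shows "y \<in> full_annihilator"
proof -
  let ?V = "{x. \<forall>b c. comm x b * c * y = 0}"
  have "csubspace ?V"
    unfolding csubspace_def
  proof (intro conjI ballI allI)
    show "0 \<in> ?V" by (simp add: comm_def)
    fix v w assume vw: "v \<in> ?V" "w \<in> ?V"
    have "comm (v + w) b = comm v b + comm w b" for b
      by (simp add: comm_def algebra_simps)
    then show "v + w \<in> ?V" using vw by (simp add: distrib_right)
  next
    fix k v assume v: "v \<in> ?V"
    have "comm (smul k v) b = smul k (comm v b)" for b
      by (simp add: comm_def mult_smul_left mult_smul_right smul_diff_right)
    then show "smul k v \<in> ?V" using v by (simp add: mult_smul_left smul_zero_right)
  qed
  moreover have "Q \<subseteq> ?V" using assms(2) by (auto simp: comm_annihilator_def)
  ultimately have "?V = UNIV" using assms(1) unfolding spanning_def by blast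
  then show ?thesis unfolding full_annihilator_def by blast
qed

text \<open>The derivations \<open>comm p\<close> and \<open>comm x\<close> compose to zero, so by
  the Leibniz rule they can be exchanged in a product at the cost of a sign. As \<open>p\<close>
  commutes with the values of \<open>comm x\<close>, this forces
  \<open>comm p c * d * comm x b = 0\<close>, which puts \<open>comm x b\<close> into
  \<open>full_annihilator\<close>.\<close>

lemma central_if_comm_commute:
  assumes p: "projection p" and full: "comm_annihilator p \<subseteq> full_annihilator"
    and x: "\<And>a. comm p (comm x a) = 0"
  shows "comm x b = 0"
proof -
  have px: "p * comm x a = comm x a * p" for a
    using x[of a] by (simp add: comm_def)
  have 1: "comm p c * comm x b = - (comm x c * comm p b)" for b c
  proof -
    have "comm p (comm x c * b + c * comm x b) = 0"
      using x[of "c * b"] by (simp add: comm_mult_right)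
    moreover have "comm p (comm x c * b + c * comm x b)
        = comm p (comm x c) * b + comm x c * comm p b + (comm p c * comm x b + c * comm p (comm x b))"
      by (simp add: comm_def algebra_simps)
    ultimately have "comm x c * comm p b + comm p c * comm x b = 0" by (simp add: x)
    then show ?thesis by (simp add: eq_neg_iff_add_eq_0 add.commute)
  qed
  \<comment> \<open>Replacing \<open>c\<close> by \<open>c * d\<close> in the exchange rule inserts
    an arbitrary middle factor.\<close>
  have 2: "comm p c * d * comm x b = - (comm x c * d * comm p b)" for b c d
  proof -
    have "(comm p c * d + c * comm p d) * comm x b = - ((comm x c * d + c * comm x d) * comm p b)"
      using 1[of "c * d" b] by (simp add: comm_mult_right)
    moreover have "c * comm p d * comm x b = - (c * comm x d * comm p b)"
      using 1[of d b] by (simp add: mult.assoc)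
    ultimately have "comm p c * d * comm x b + c * comm p d * comm x b
        = - (comm x c * d * comm p b) + c * comm p d * comm x b"
      by (simp only: distrib_right minus_add_distrib)
    then show ?thesis by (simp only: add_right_cancel)
  qed
  \<comment> \<open>The exchange is made twice, with \<open>p\<close> moved past
    \<open>comm x c\<close> in between.\<close>
  have 3: "(comm p c * p - p * comm p c) * d * comm x b = 0" for b c d
  proof -
    have "comm p c * p * d * comm x b = - (comm x c * p * d * comm p b)"
      using 2[of c "p * d" b] by (simp add: mult.assoc)
    also have "comm x c * p = p * comm x c" by (simp add: px)
    also have "- (p * comm x c * d * comm p b) = p * comm p c * d * comm x b"
      using 2[of c d b] by (simp add: mult.assoc)
    finally show ?thesis by (simp add: left_diff_distrib)
  qed
  have pp: "p * p = p" "p * (p * a) = p * a" for a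
    using p by (simp_all add: projection_def flip: mult.assoc)
  have 4: "comm p c * d * comm x b = 0" for b c d
  proof -
    have eq: "comm p c * p - p * comm p c = p * c * p - c * p - p * c + p * c * p"
      by (simp add: comm_def pp algebra_simps)
    \<comment> \<open>A further factor \<open>p\<close> on either side isolates, up to sign, the
      corners \<open>p * c * (1 - p)\<close> and \<open>(1 - p) * c * p\<close>; their difference is
      \<open>comm p c\<close>.\<close>
    have l: "(p * c * p - p * c) * d * comm x b = 0"
    proof -
      have "p * ((comm p c * p - p * comm p c) * d * comm x b) = 0"
        by (simp add: 3)
      moreover have "p * ((comm p c * p - p * comm p c) * d * comm x b) = (p * c * p - p * c) * d * comm x b"
        unfolding eq by (simp add: algebra_simps pp)
      ultimately show ?thesis by simp
    qed
    have r: "(p * c * p - c * p) * d * comm x b = 0"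
    proof -
      have "(comm p c * p - p * comm p c) * (p * d) * comm x b = (p * c * p - c * p) * d * comm x b"
        unfolding eq by (simp add: algebra_simps pp)
      with 3[of c "p * d" b] show ?thesis by simp
    qed
    have "comm p c * d * comm x b = (p * c * p - c * p) * d * comm x b - (p * c * p - p * c) * d * comm x b"
      by (simp add: comm_def algebra_simps)
    then show ?thesis using l r by simp
  qed
  then have "comm x b \<in> full_annihilator"
    using full by (auto simp: comm_annihilator_def)
  \<comment> \<open>The first factor is the adjoint of \<open>comm x b\<close>, so faithfulness
    applies.\<close>
  then have "comm (star b) (star x) * 1 * comm x b = 0"
    unfolding full_annihilator_def by blast
  then show ?thesis
    using star_mult_eq_0[of "comm x b"] by (simp add: star_comm)
qed

text \<open>For \<open>cmod z = 1\<close> and a projection \<open>q\<close>, \<open>rotation z q\<close> is unitary.\<close>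

definition rotation :: "complex \<Rightarrow> 'a \<Rightarrow> 'a" where
  "rotation z q = 1 + smul (z - 1) q"

definition rotate :: "complex \<Rightarrow> 'a \<Rightarrow> 'a \<Rightarrow> 'a" where
  "rotate z q p = rotation z q * p * rotation (cnj z) q"

text \<open>\<open>rotation z q\<close> acts as \<open>z\<close> on the range of \<open>q\<close>
  and as 1 on its complement, so the parameters multiply.\<close>

lemma rotation_mult:
  assumes "projection q"
  shows "rotation z q * rotation w q = rotation (z * w) q"
proof -
  have "rotation z q * rotation w q = 1 + (smul (w - 1) q + smul (z - 1) q + smul ((z - 1) * (w - 1)) q)"
    using assms by (simp add: rotation_def projection_def distrib_left distrib_right
        mult_smul_left mult_smul_right smul_smul smul_add_right ac_simps)
  also have "\<dots> = 1 + smul ((w - 1) + (z - 1) + (z - 1) * (w - 1)) q"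
    by (simp only: smul_add_left)
  also have "(w - 1) + (z - 1) + (z - 1) * (w - 1) = z * w - 1" by (simp add: algebra_simps)
  finally show ?thesis by (simp add: rotation_def)
qed

lemma star_rotation: "projection q \<Longrightarrow> star (rotation z q) = rotation (cnj z) q"
  by (simp add: rotation_def star_add star_one star_smul projection_def)

lemma rotation_inverse:
  assumes "projection q" "cmod z = 1"
  shows "rotation (cnj z) q * rotation z q = 1" "rotation z q * rotation (cnj z) q = 1"
proof -
  have "z * cnj z = 1" using assms(2) by (simp add: complex_norm_square[symmetric])
  then show "rotation (cnj z) q * rotation z q = 1" "rotation z q * rotation (cnj z) q = 1"
    using rotation_mult[OF assms(1)]
    by (simp_all add: mult.commute) (simp_all add: rotation_def smul_zero_left)
qed

lemma projection_rotate:
  assumes p: "projection p" and q: "projection q" "cmod z = 1"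
  shows "projection (rotate z q p)"
proof -
  let ?u = "rotation z q" and ?v = "rotation (cnj z) q"
  have "rotate z q p * rotate z q p = ?u * p * (?v * ?u) * p * ?v"
    by (simp add: rotate_def mult.assoc)
  also have "\<dots> = rotate z q p"
    using p by (simp add: rotation_inverse[OF q] rotate_def projection_def mult.assoc)
  finally show ?thesis
    using p by (simp add: projection_def rotate_def star_mult star_rotation[OF q(1)] mult.assoc)
qed

text \<open>Conjugation carries commutators with \<open>p\<close> to commutators with
  \<open>rotate z q p\<close>; the unitaries left over are absorbed into the free arguments
  \<open>a\<close> and \<open>c\<close>.\<close>

lemma comm_annihilator_rotate:
  assumes q: "projection q" "cmod z = 1"
  shows "comm_annihilator (rotate z q p) \<subseteq> comm_annihilator p"
proof
  let ?u = "rotation z q" and ?v = "rotation (cnj z) q"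
  fix y assume y: "y \<in> comm_annihilator (rotate z q p)"
  have vu: "?v * ?u = 1" "?v * (?u * a) = a" for a
    using rotation_inverse[OF q] by (simp_all flip: mult.assoc)
  have "comm p a * c * y = 0" for a c
  proof -
    have "comm p a * c * y = ?v * (comm (rotate z q p) (?u * a * ?v) * (?u * c) * y)"
      by (simp add: comm_def rotate_def algebra_simps vu)
    then show ?thesis using y by (simp add: comm_annihilator_def)
  qed
  then show "y \<in> comm_annihilator p" by (simp add: comm_annihilator_def)
qed

lemma rotate_expand:
  "rotate z q p = p + smul (z - 1) (q * p) + smul (cnj z - 1) (p * q)
     + smul ((z - 1) * (cnj z - 1)) (q * p * q)"
  by (simp add: rotate_def rotation_def distrib_left distrib_right mult_smul_left mult_smul_right
      smul_smul smul_add_right mult.assoc add.assoc mult.commute[of "z - 1"])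

text \<open>The quadratic term of \<open>rotate_expand\<close> is the same for \<open>z\<close> and
  \<open>cnj z\<close> and cancels, so an exact difference replaces the derivative at angle
  zero.\<close>

lemma rotate_diff: "rotate z q p - rotate (cnj z) q p = smul (z - cnj z) (comm q p)"
proof -
  have "rotate z q p - rotate (cnj z) q p
      = (smul (z - 1) (q * p) - smul (cnj z - 1) (q * p)) + (smul (cnj z - 1) (p * q) - smul (z - 1) (p * q))"
    by (simp add: rotate_expand mult.commute algebra_simps)
  also have "\<dots> = smul (z - cnj z) (q * p) + smul (cnj z - z) (p * q)"
    by (simp flip: smul_diff_left)
  also have "\<dots> = smul (z - cnj z) (comm q p)"
    using smul_minus_left[of "z - cnj z" "p * q"] by (simp add: comm_def smul_diff_right)
  finally show ?thesis .
qed

lemma tau_rotate: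
  "tau (x * rotate z q p) = tau (x * p) + (z - 1) * tau (x * (q * p)) + (cnj z - 1) * tau (x * (p * q))
     + (z - 1) * (cnj z - 1) * tau (x * (q * p * q))"
  by (simp add: rotate_expand distrib_left mult_smul_right tau_add tau_smul)

text \<open>Continuity at angle zero keeps finitely many nonzero values nonzero. A nonreal
  \<open>z\<close> is demanded so that \<open>z - cnj z\<close> can be divided out later.\<close>

lemma ex_rotation_preserving_nonzero:
  assumes "finite X" "\<forall>x\<in>X. tau (x * p) \<noteq> 0"
  shows "\<exists>z. cmod z = 1 \<and> z \<noteq> cnj z \<and>
    (\<forall>x\<in>X. tau (x * rotate z q p) \<noteq> 0 \<and> tau (x * rotate (cnj z) q p) \<noteq> 0)"
proof -
  have lim: "((\<lambda>t. tau (x * rotate (cis t) q p)) \<longlongrightarrow> tau (x * p)) (at 0)"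
    "((\<lambda>t. tau (x * rotate (cnj (cis t)) q p)) \<longlongrightarrow> tau (x * p)) (at 0)" for x
    unfolding tau_rotate cis_conv_exp by (auto intro!: tendsto_eq_intros)
  have "\<forall>\<^sub>F t in at 0. \<forall>x\<in>X. tau (x * rotate (cis t) q p) \<noteq> 0 \<and> tau (x * rotate (cnj (cis t)) q p) \<noteq> 0"
    using assms by (intro eventually_ball_finite ballI eventually_conj tendsto_imp_eventually_ne[OF lim(1)]
        tendsto_imp_eventually_ne[OF lim(2)]) auto
  \<comment> \<open>The bound 1 is below \<open>pi\<close>, so \<open>sin t\<close> is nonzero for
    the nonzero angle chosen below.\<close>
  moreover have "\<forall>\<^sub>F t in at 0. t \<noteq> 0 \<and> \<bar>t\<bar> < (1::real)"
    unfolding eventually_at by (intro exI[of _ "1::real"]) auto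
  ultimately have "\<forall>\<^sub>F t in at 0. (\<forall>x\<in>X. tau (x * rotate (cis t) q p) \<noteq> 0 \<and>
      tau (x * rotate (cnj (cis t)) q p) \<noteq> 0) \<and> t \<noteq> 0 \<and> \<bar>t\<bar> < 1"
    by (rule eventually_conj)
  then obtain t :: real where t: "\<forall>x\<in>X. tau (x * rotate (cis t) q p) \<noteq> 0 \<and>
      tau (x * rotate (cnj (cis t)) q p) \<noteq> 0" "t \<noteq> 0" "\<bar>t\<bar> < 1"
    using eventually_happens'[OF trivial_limit_at] by blast
  have "sin t \<noteq> 0"
    using t(2,3) pi_gt3 sin_gt_zero[of t] sin_gt_zero[of "- t"] by (cases "t > 0") auto
  then have "cis t \<noteq> cnj (cis t)"
    by (auto simp: complex_eq_iff)
  with t(1) show ?thesis by (intro exI[of _ "cis t"]) simp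
qed

section \<open>Vanishing along rotation orbits and the maximality argument\<close>

lemma spanning_linear_eq_0:
  fixes h :: "'a \<Rightarrow> complex"
  assumes "spanning Q" and add: "\<And>a b. h (a + b) = h a + h b" and smul: "\<And>c a. h (smul c a) = c * h a"
    and "\<And>q. q \<in> Q \<Longrightarrow> h q = 0"
  shows "h a = 0"
proof -
  have "h 0 = 0" using smul[of 0 0] by (simp add: smul_zero_left)
  then have "csubspace {a. h a = 0}"
    by (simp add: csubspace_def add smul)
  moreover have "Q \<subseteq> {a. h a = 0}" using assms(4) by auto
  ultimately have "{a. h a = 0} = UNIV" using assms(1) unfolding spanning_def by blast
  then show ?thesis by blast
qed

lemma comm_add_left: "comm (a + b) d = comm a d + comm b d"
  by (simp add: comm_def algebra_simps)

lemma comm_smul_left: "comm (smul c a) d = smul c (comm a d)"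
  by (simp add: comm_def mult_smul_left mult_smul_right smul_diff_right)

lemma comm_add_right: "comm d (a + b) = comm d a + comm d b"
  by (simp add: comm_def algebra_simps)

lemma comm_smul_right: "comm d (smul c a) = smul c (comm d a)"
  by (simp add: comm_def mult_smul_left mult_smul_right smul_diff_right)

lemma comm_diff_right: "comm d (a - b) = comm d a - comm d b"
  by (simp add: comm_def algebra_simps)

text \<open>Second-order differentiation of the vanishing functional along the rotation orbits: the
  antisymmetrised difference of the rotations by \<open>z\<close> and \<open>cnj z\<close> is a multiple of a commutator.\<close>

lemma comm_comm_eq_0_if_tau_vanishes:
  assumes Q: "spanning Q" and M: "\<And>p. p \<in> M \<Longrightarrow> tau (x * p) = 0"
    and rot: "\<And>p q. p \<in> M \<Longrightarrow> q \<in> Q \<Longrightarrow>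
      \<exists>z. z \<noteq> cnj z \<and> rotate z q p \<in> M \<and> rotate (cnj z) q p \<in> M"
    and p: "p \<in> M"
  shows "comm p (comm x a) = 0"
proof -
  \<comment> \<open>First derivative. It is established at every point of \<open>M\<close>, so that
    it can be differentiated again at the rotated points.\<close>
  have 1: "tau (x * comm a p) = 0" if p: "p \<in> M" for a p
  proof (rule spanning_linear_eq_0[OF Q, of "\<lambda>a. tau (x * comm a p)"])
    fix q assume "q \<in> Q"
    then obtain z where z: "z \<noteq> cnj z" "rotate z q p \<in> M" "rotate (cnj z) q p \<in> M"
      using rot p by blast
    have "tau (x * (rotate z q p - rotate (cnj z) q p)) = 0"
      using M[OF z(2)] M[OF z(3)] by (simp add: right_diff_distrib tau_diff)
    then show "tau (x * comm q p) = 0"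
      using z(1) by (simp add: rotate_diff mult_smul_right tau_smul)
  qed (simp_all add: comm_add_left comm_smul_left distrib_left tau_add mult_smul_right tau_smul)
  have 2: "tau (x * comm a (comm b p)) = 0" for a b
  proof (rule spanning_linear_eq_0[OF Q, of "\<lambda>b. tau (x * comm a (comm b p))"])
    fix q assume "q \<in> Q"
    then obtain z where z: "z \<noteq> cnj z" "rotate z q p \<in> M" "rotate (cnj z) q p \<in> M"
      using rot p by blast
    have "tau (x * comm a (rotate z q p - rotate (cnj z) q p)) = 0"
      using 1[OF z(2)] 1[OF z(3)] by (simp add: comm_diff_right right_diff_distrib tau_diff)
    then show "tau (x * comm a (comm q p)) = 0"
      using z(1) by (simp add: rotate_diff comm_smul_right mult_smul_right tau_smul)
  qed (simp_all add: comm_add_left comm_smul_left comm_add_right comm_smul_right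
      distrib_left tau_add mult_smul_right tau_smul)
  let ?w = "comm x a"
  \<comment> \<open>The trace property moves both commutators off \<open>p\<close>, leaving
    \<open>b\<close> free for nondegeneracy.\<close>
  have "tau (b * comm p ?w) = 0" for b
  proof -
    have "tau (x * comm a (comm b p)) = tau (?w * comm b p)"
      using tau_commute[of "x * comm b p" a] by (simp add: comm_def[of _ "comm b p"] comm_def[of x]
          right_diff_distrib left_diff_distrib tau_diff mult.assoc)
    also have "\<dots> = tau (b * comm p ?w)"
      using tau_commute[of ?w "b * p"] tau_commute[of "?w * p" b]
      by (simp add: comm_def[of b] comm_def[of p] right_diff_distrib tau_diff mult.assoc)
    finally show ?thesis using 2 by simp
  qed
  then show ?thesis by (rule eq_0_if_tau_orthogonal)
qed

text \<open>A projection with the most nonzero values on \<open>X\<close> is chosen among those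
  nonscalar in every noncommutative block. Small rotations lose none of these values and by
  maximality gain none, so the zeros persist.\<close>

theorem ex_separating_projection:
  assumes Q: "finite Q" "spanning Q" "\<forall>q\<in>Q. projection q" and X: "finite X"
  shows "\<exists>p. projection p \<and> (\<forall>x\<in>X. tau (x * p) = 0 \<longrightarrow> (\<forall>b. comm x b = 0))"
proof -
  define C where "C = {p. projection p \<and> comm_annihilator p \<subseteq> full_annihilator}"
  define S where "S p = {x \<in> X. tau (x * p) \<noteq> 0}" for p
  obtain p0 where "projection p0" "\<forall>q\<in>Q. comm_annihilator p0 \<subseteq> comm_annihilator q"
    using ex_projection_comm_annihilator[OF Q(1,3)] by blast
  then have "p0 \<in> C"
    unfolding C_def using spanning_comm_annihilator[OF Q(2)] by blast
  moreover have "\<forall>p. p \<in> C \<longrightarrow> card (S p) < Suc (card X)"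
    using X by (simp add: S_def card_mono less_Suc_eq_le)
  ultimately obtain p where p: "p \<in> C" and max: "\<And>p'. p' \<in> C \<Longrightarrow> card (S p') \<le> card (S p)"
    using ex_has_greatest_nat[of "\<lambda>p. p \<in> C" p0 "\<lambda>p. card (S p)" "Suc (card X)"] by blast
  \<comment> \<open>All maximisers with the same zeros as \<open>p\<close>: a set closed under
    suitable rotations, as two differentiations require.\<close>
  define M where "M = {p' \<in> C. S p' = S p}"
  have M: "p' \<in> M" if "p' \<in> C" "S p \<subseteq> S p'" for p'
    using that max[OF that(1)] X card_seteq[of "S p'" "S p"] by (simp add: M_def S_def)
  have rot: "\<exists>z. z \<noteq> cnj z \<and> rotate z q p' \<in> M \<and> rotate (cnj z) q p' \<in> M"
    if p': "p' \<in> M" and q: "q \<in> Q" for p' q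
  proof -
    have "finite (S p')" "\<forall>x\<in>S p'. tau (x * p') \<noteq> 0"
      using X by (auto simp: S_def)
    from ex_rotation_preserving_nonzero[OF this, of q]
    obtain z where z: "cmod z = 1" "z \<noteq> cnj z"
      "\<forall>x\<in>S p'. tau (x * rotate z q p') \<noteq> 0 \<and> tau (x * rotate (cnj z) q p') \<noteq> 0" by blast
    have C: "rotate w q p' \<in> C" if "cmod w = 1" for w
      using p' q Q(3) that projection_rotate[of p' q w] comm_annihilator_rotate[of q w p']
      unfolding M_def C_def by blast
    have "S p \<subseteq> S (rotate z q p')" "S p \<subseteq> S (rotate (cnj z) q p')"
      using z(3) p' unfolding M_def S_def by blast+
    then show ?thesis using z(1,2) C M by (metis complex_mod_cnj)
  qed
  have "comm x b = 0" if x: "x \<in> X" "tau (x * p) = 0" for x b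
  proof (rule central_if_comm_commute[of p])
    show "comm p (comm x a) = 0" for a
    proof (rule comm_comm_eq_0_if_tau_vanishes[OF Q(2) _ rot])
      show "tau (x * p') = 0" if "p' \<in> M" for p'
        using that x unfolding M_def S_def by blast
      show "p \<in> M" using p by (simp add: M_def)
    qed
  qed (use p in \<open>auto simp: C_def\<close>)
  then show ?thesis using p unfolding C_def by blast
qed

section \<open>Spectral projections of unitaries of finite order\<close>

lemma star_sum: "finite A \<Longrightarrow> star (\<Sum>i\<in>A. f i) = (\<Sum>i\<in>A. star (f i))"
  by (induction A rule: finite_induct) (simp_all add: star_zero star_add)

lemma smul_sum: "finite A \<Longrightarrow> smul c (\<Sum>i\<in>A. f i) = (\<Sum>i\<in>A. smul c (f i))"
  by (induction A rule: finite_induct) (simp_all add: smul_zero_right smul_add_right)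

lemma smul_sum_left: "finite A \<Longrightarrow> smul (\<Sum>i\<in>A. f i) x = (\<Sum>i\<in>A. smul (f i) x)"
  by (induction A rule: finite_induct) (simp_all add: smul_zero_left smul_add_left)

lemma smul_power: "(smul c x) ^ n = smul (c ^ n) (x ^ n)"
  by (induction n) (simp_all add: smul_one mult_smul_left mult_smul_right smul_smul mult.commute)

text \<open>This is the projection onto the vectors fixed by \<open>v\<close>: the sum of the powers
  is invariant under \<open>v\<close> and \<open>star v\<close>, so its product with its adjoint is
  \<open>n\<close> times the sum.\<close>

lemma projection_average:
  assumes v: "star v * v = 1" "v ^ n = 1" and n: "n > 0"
  shows "projection (smul (1 / of_nat n) (\<Sum>j<n. v ^ j))"
proof -
  let ?s = "\<Sum>j<n. v ^ j" and ?c = "1 / of_nat n :: complex"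
  have "v * ?s + 1 = (\<Sum>j<Suc n. v ^ j)"
    by (simp only: sum.lessThan_Suc_shift) (simp add: sum_distrib_left add.commute)
  then have "v * ?s = ?s" using v(2) by simp
  then have "star v * ?s = star v * (v * ?s)" by simp
  then have *: "star v * ?s = ?s" using v(1) by (simp flip: mult.assoc)
  have "star (v ^ j) * ?s = ?s" for j
    by (induction j) (simp_all add: star_one star_mult mult.assoc *)
  then have "star ?s * ?s = (\<Sum>j<n. ?s)"
    by (simp add: star_sum sum_distrib_right del: sum_constant)
  also have "\<dots> = (\<Sum>j<n. smul 1 ?s)" by (simp only: smul_one)
  also have "\<dots> = smul (\<Sum>j<n. 1) ?s" by (simp only: smul_sum_left finite_lessThan)
  finally have "star (smul ?c ?s) * smul ?c ?s = smul ?c ?s"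
    using n by (simp add: star_smul mult_smul_left mult_smul_right smul_smul)
  \<comment> \<open>Since \<open>star q * q\<close> is always selfadjoint,
    \<open>star q * q = q\<close> gives both conditions for a projection.\<close>
  moreover from this have "star (smul ?c ?s) = smul ?c ?s"
    by (metis star_mult star_star)
  ultimately show ?thesis by (simp add: projection_def)
qed

text \<open>The spectral decomposition of \<open>v\<close> over the roots of unity of order dividing
  \<open>n\<close>, obtained by Fourier inversion.\<close>

lemma ex_projections_span_unitary:
  assumes v: "star v * v = 1" "v ^ n = 1" and n: "n > 1"
  shows "\<exists>Q. finite Q \<and> (\<forall>q\<in>Q. projection q) \<and> (\<forall>V. csubspace V \<longrightarrow> Q \<subseteq> V \<longrightarrow> v \<in> V)"
proof -
  define w where "w k = exp (2 * of_real pi * \<i> * of_nat k / of_nat n)" for k :: nat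
  have wn: "w k ^ n = 1" for k
    using n complex_root_unity[of n] by (simp add: w_def)
  have w0: "w k \<noteq> 0" and wcnj: "cnj (w k) = inverse (w k)" for k
    by (simp_all add: w_def exp_cnj exp_minus)
  have wpow: "w k ^ j = w j ^ k" for k j
    by (simp add: w_def exp_of_nat_mult[symmetric] mult.commute mult.left_commute)
  \<comment> \<open>The spectral projection for \<open>w k\<close>: the fixed-vector average of
    \<open>smul (inverse (w k)) v\<close>, whose \<open>n\<close>-th power is again 1.\<close>
  define q where "q k = smul (1 / of_nat n) (\<Sum>j<n. (smul (inverse (w k)) v) ^ j)" for k
  have "projection (q k)" for k
    unfolding q_def using n wn[of k] w0[of k] wcnj[of k] v
    by (intro projection_average)
       (simp_all add: star_smul mult_smul_left mult_smul_right smul_smul smul_one smul_power power_inverse)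
  moreover have "v = (\<Sum>k<n. smul (w k) (q k))"
  proof -
    have "(\<Sum>k<n. smul (w k) (q k)) = (\<Sum>k<n. \<Sum>j<n. smul ((w 1 / w j) ^ k / of_nat n) (v ^ j))"
    proof (rule sum.cong[OF refl])
      fix k
      have "w k * (1 / of_nat n * inverse (w k) ^ j) = (w 1 / w j) ^ k / of_nat n" for j
        using wpow[of k j] wpow[of k 1] by (simp add: power_mult_distrib power_inverse divide_inverse)
      then show "smul (w k) (q k) = (\<Sum>j<n. smul ((w 1 / w j) ^ k / of_nat n) (v ^ j))"
        by (simp only: q_def smul_sum smul_smul smul_power finite_lessThan)
    qed
    also have "\<dots> = (\<Sum>j<n. smul (\<Sum>k<n. (w 1 / w j) ^ k / of_nat n) (v ^ j))"
      by (subst sum.swap) (simp add: smul_sum_left)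
    \<comment> \<open>For \<open>j \<noteq> 1\<close> the ratio \<open>w 1 / w j\<close> is a
      nontrivial \<open>n\<close>-th root of unity and its geometric sum vanishes;
      \<open>n > 1\<close> ensures that the index 1 occurs.\<close>
    also have "\<dots> = (\<Sum>j<n. if j = 1 then v else 0)"
    proof (rule sum.cong[OF refl])
      fix j assume j: "j \<in> {..<n}"
      show "smul (\<Sum>k<n. (w 1 / w j) ^ k / of_nat n) (v ^ j) = (if j = 1 then v else 0)"
      proof (cases "j = 1")
        case True
        then show ?thesis using n w0[of 1] by (simp add: smul_one)
      next
        case False
        have "w 1 \<noteq> w j"
          unfolding w_def using complex_root_unity_eq[of n 1 j] n j False by (simp add: cong_def)
        then have "w 1 / w j \<noteq> 1" using w0[of j] by simp
        from geometric_sum[OF this, of n] have "(\<Sum>k<n. (w 1 / w j) ^ k) = 0"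
          by (simp only: power_divide wn) simp
        then have "(\<Sum>k<n. (w 1 / w j) ^ k / of_nat n) = 0"
          by (simp only: sum_divide_distrib[symmetric]) simp
        then show ?thesis using False by (simp add: smul_zero_left)
      qed
    qed
    also have "\<dots> = v" using n by (simp add: sum.delta)
    finally show ?thesis by simp
  qed
  moreover have "(\<Sum>k\<in>A. smul (w k) (q k)) \<in> V" if "csubspace V" "q ` {..<n} \<subseteq> V" "A \<subseteq> {..<n}" for V A
    using finite_subset[OF that(3) finite_lessThan] that
    by (induction A rule: finite_induct) (auto simp: csubspace_def)
  ultimately show ?thesis by (intro exI[of _ "q ` {..<n}"]) auto
qed

end

section \<open>Separating projections in the group algebra\<close>

text \<open>Real orthogonal decomposition gives only vanishing real parts; as \<open>V\<close> is
  closed under multiplication by \<open>\<i>\<close>, the imaginary parts vanish too.\<close>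

lemma ex_orthogonal_component:
  fixes V :: "('g::finite \<Rightarrow> complex) set"
  assumes zero: "(\<lambda>g. 0) \<in> V" and add: "\<And>x y. x \<in> V \<Longrightarrow> y \<in> V \<Longrightarrow> (\<lambda>g. x g + y g) \<in> V"
    and smul: "\<And>c x. x \<in> V \<Longrightarrow> (\<lambda>g. c * x g) \<in> V"
  shows "\<exists>f\<in>V. \<forall>y\<in>V. (\<Sum>g\<in>UNIV. cnj (y g) * (x g - f g)) = 0"
proof -
  define W where "W = {v :: complex ^ 'g. ($) v \<in> V}"
  have "($) (0 :: complex ^ 'g) = (\<lambda>g. 0)" "($) (v + w) = (\<lambda>g. v $ g + w $ g)"
    "($) (c *\<^sub>R v) = (\<lambda>g. of_real c * v $ g)" for v w :: "complex ^ 'g" and c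
    by (simp_all add: fun_eq_iff scaleR_conv_of_real[where 'a = complex])
  then have "subspace W"
    unfolding subspace_def W_def using zero add smul by simp
  then have span: "span W = W" by (simp add: span_eq_iff)
  obtain v z where vz: "v \<in> W" "\<And>w. w \<in> W \<Longrightarrow> orthogonal z w" "(\<chi> g. x g) = v + z"
    using orthogonal_subspace_decomp_exists[of W "\<chi> g. x g"] span by metis
  have z: "z $ g = x g - v $ g" for g
    using arg_cong[OF vz(3), of "\<lambda>u. u $ g"] by simp
  have "(\<Sum>g\<in>UNIV. cnj (y g) * z $ g) = 0" if y: "y \<in> V" for y
  proof -
    have Re0: "Re (\<Sum>g\<in>UNIV. cnj (y g) * z $ g) = 0" if y: "y \<in> V" for y
    proof -
      have "orthogonal z (\<chi> g. y g)" using y by (intro vz(2)) (simp add: W_def vec_lambda_inverse)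
      then show ?thesis
        by (simp add: orthogonal_def inner_vec_def inner_complex_def mult.commute)
    qed
    have "Re (\<Sum>g\<in>UNIV. cnj (\<i> * y g) * z $ g) = 0"
      using Re0[OF smul[OF y]] .
    moreover have "(\<Sum>g\<in>UNIV. cnj (\<i> * y g) * z $ g) = - \<i> * (\<Sum>g\<in>UNIV. cnj (y g) * z $ g)"
      by (simp add: sum_distrib_left mult.assoc)
    ultimately show ?thesis using Re0[OF y] by (simp add: complex_eq_iff)
  qed
  then show ?thesis using vz(1) z by (intro bexI[of _ "($) v"]) (auto simp: W_def)
qed

locale full_group = group G for G :: "('g::finite, 'm) monoid_scheme" (structure) +
  assumes carrier_UNIV: "carrier G = UNIV"
begin

lemma in_carrier [simp]: "x \<in> carrier G"
  by (simp add: carrier_UNIV)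

lemma sum_translate: "(\<Sum>h\<in>UNIV. f (a \<otimes> h)) = (\<Sum>h\<in>UNIV. f h)"
  by (rule sum.reindex_bij_witness[of _ "\<lambda>h. inv a \<otimes> h" "\<lambda>h. a \<otimes> h"])
    (simp_all flip: m_assoc)

lemma sum_inv: "(\<Sum>h\<in>UNIV. f (inv h)) = (\<Sum>h\<in>UNIV. f h)"
  by (rule sum.reindex_bij_witness[of _ "\<lambda>h. inv h" "\<lambda>h. inv h"]) simp_all

lemma cg_mult_delta_left: "cg_mult G (cg_delta a) x = (\<lambda>g. x (inv a \<otimes> g))"
  by (simp add: cg_mult_def cg_delta_def fun_eq_iff if_distrib[of "\<lambda>c. c * _"] cong: if_cong)

lemma cg_delta_translate: "cg_delta b (inv a \<otimes> g) = cg_delta (a \<otimes> b) g"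
proof -
  have "inv a \<otimes> g = b \<longleftrightarrow> g = a \<otimes> b"
    by (metis in_carrier inv_solve_left)
  then show ?thesis by (simp add: cg_delta_def)
qed

lemma cg_mult_delta_delta: "cg_mult G (cg_delta a) (cg_delta b) = cg_delta (a \<otimes> b)"
  by (simp add: cg_mult_delta_left cg_delta_translate fun_eq_iff)

lemma cg_mult_assoc: "cg_mult G (cg_mult G x y) z = cg_mult G x (cg_mult G y z)"
proof
  fix g
  have "cg_mult G (cg_mult G x y) z g = (\<Sum>k\<in>UNIV. \<Sum>h\<in>UNIV. x k * (y (inv k \<otimes> h) * z (inv h \<otimes> g)))"
    unfolding cg_mult_def sum_distrib_right by (subst sum.swap) (simp add: mult.assoc)
  also have "\<dots> = (\<Sum>k\<in>UNIV. \<Sum>h\<in>UNIV. x k * (y h * z (inv h \<otimes> (inv k \<otimes> g))))"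
  proof (rule sum.cong[OF refl])
    fix k
    show "(\<Sum>h\<in>UNIV. x k * (y (inv k \<otimes> h) * z (inv h \<otimes> g)))
        = (\<Sum>h\<in>UNIV. x k * (y h * z (inv h \<otimes> (inv k \<otimes> g))))"
      by (subst sum_translate[of _ k, symmetric]) (simp add: inv_mult_group m_assoc[symmetric])
  qed
  finally show "cg_mult G (cg_mult G x y) z g = cg_mult G x (cg_mult G y z) g"
    by (simp add: cg_mult_def sum_distrib_left)
qed

lemma cg_mult_one_left: "cg_mult G (cg_one G) x = x"
  by (simp add: cg_one_def cg_mult_delta_left)

lemma cg_star_mult: "cg_star G (cg_mult G x y) = cg_mult G (cg_star G y) (cg_star G x)"
proof
  fix g
  have "cg_mult G (cg_star G y) (cg_star G x) g = (\<Sum>h\<in>UNIV. cnj (y (inv h)) * cnj (x (inv (inv h \<otimes> g))))"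
    by (simp add: cg_mult_def cg_star_def)
  also have "\<dots> = (\<Sum>h\<in>UNIV. cnj (y (inv (g \<otimes> h))) * cnj (x (inv (inv (g \<otimes> h) \<otimes> g))))"
    by (rule sum_translate[symmetric])
  also have "\<dots> = (\<Sum>h\<in>UNIV. cnj (y (inv h \<otimes> inv g)) * cnj (x h))"
    by (simp add: inv_mult_group m_assoc)
  also have "\<dots> = cg_star G (cg_mult G x y) g"
    by (simp add: cg_mult_def cg_star_def mult.commute)
  finally show "cg_star G (cg_mult G x y) g = cg_mult G (cg_star G y) (cg_star G x) g" by simp
qed

lemma cg_star_star [simp]: "cg_star G (cg_star G x) = x"
  by (simp add: cg_star_def)

lemma cg_star_delta: "cg_star G (cg_delta a) = cg_delta (inv a)"
proof -
  have "inv g = a \<longleftrightarrow> g = inv a" for g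
    by (metis in_carrier inv_inv)
  then show ?thesis by (simp add: cg_star_def cg_delta_def fun_eq_iff)
qed

lemma cg_star_one: "cg_star G (cg_one G) = cg_one G"
  by (simp add: cg_one_def cg_star_delta)

lemma cg_mult_one_right: "cg_mult G x (cg_one G) = x"
  by (metis cg_mult_one_left cg_star_mult cg_star_one cg_star_star)

text \<open>The trace pairing is the standard Hermitian one on coefficients, the source of
  faithfulness and of orthogonal components.\<close>

lemma tau_star_mult: "cg_mult G (cg_star G x) y \<one> = (\<Sum>h\<in>UNIV. cnj (x h) * y h)"
  using sum_inv[of "\<lambda>h. cnj (x h) * y h"] by (simp add: cg_mult_def cg_star_def)

lemma cg_mult_linear:
  "cg_mult G (\<lambda>g. x g + y g) z = (\<lambda>g. cg_mult G x z g + cg_mult G y z g)"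
  "cg_mult G x (\<lambda>g. y g + z g) = (\<lambda>g. cg_mult G x y g + cg_mult G x z g)"
  "cg_mult G (\<lambda>g. c * x g) y = (\<lambda>g. c * cg_mult G x y g)"
  "cg_mult G x (\<lambda>g. c * y g) = (\<lambda>g. c * cg_mult G x y g)"
  by (simp_all add: cg_mult_def distrib_left distrib_right sum.distrib sum_distrib_left mult_ac)

lemma cg_star_linear:
  "cg_star G (\<lambda>g. x g + y g) = (\<lambda>g. cg_star G x g + cg_star G y g)"
  "cg_star G (\<lambda>g. c * x g) = (\<lambda>g. cnj c * cg_star G x g)"
  by (simp_all add: cg_star_def)

lemma cg_one_neq_zero: "cg_one G \<noteq> (\<lambda>g. 0)"
  by (auto simp: cg_one_def cg_delta_def fun_eq_iff)

lemma cg_mult_commute_one: "cg_mult G x y \<one> = cg_mult G y x \<one>"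
proof -
  have "cg_mult G x y \<one> = (\<Sum>h\<in>UNIV. x h * y (inv h))"
    by (simp add: cg_mult_def)
  also have "\<dots> = (\<Sum>h\<in>UNIV. x (inv h) * y (inv (inv h)))"
    by (rule sum_inv[symmetric])
  finally show ?thesis
    by (simp add: cg_mult_def mult.commute)
qed

text \<open>The trace is \<open>cg_psi\<close> without its positive normalising factor.\<close>

sublocale cg: tracial_star_algebra
  where one = "cg_one G" and times = "cg_mult G" and plus = "\<lambda>x y g. x g + y g" and zero = "\<lambda>g. 0"
    and minus = "\<lambda>x y g. x g - y g" and uminus = "\<lambda>x g. - x g"
    and smul = "\<lambda>c x g. c * x g" and star = "cg_star G" and tau = "\<lambda>x. x \<one>"
proof (unfold_locales, goal_cases)
  case (1 a b c) show ?case by (rule cg_mult_assoc)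
next
  case (24 x y) show ?case by (rule cg_mult_commute_one)
next
  case (25 x)
  have "complex_of_real (\<Sum>h\<in>UNIV. (cmod (x h))\<^sup>2) = (\<Sum>h\<in>UNIV. cnj (x h) * x h)"
    by (simp only: of_real_sum complex_norm_square mult.commute[of "cnj _"])
  also have "\<dots> = 0" using 25 by (simp only: tau_star_mult)
  finally have "(\<Sum>h\<in>UNIV. (cmod (x h))\<^sup>2) = 0" by (simp only: of_real_eq_0_iff)
  then show ?case by (simp add: sum_nonneg_eq_0_iff fun_eq_iff)
next
  case (26 V x) then show ?case
    unfolding tau_star_mult by (rule ex_orthogonal_component)
qed (auto simp: cg_mult_one_left cg_mult_one_right cg_mult_linear cg_star_mult
    cg_star_linear cg_one_neq_zero[symmetric] distrib_left distrib_right mult.assoc)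

section \<open>Separation of the coefficients of a projection\<close>

lemma power_delta: "power.power (cg_one G) (cg_mult G) (cg_delta a) n = cg_delta (a [^] n)"
proof (induction n)
  case (Suc n)
  then show ?case using nat_pow_Suc2[of a n] by (simp add: cg_mult_delta_delta)
qed (simp add: cg_one_def[symmetric])

lemma csubspace_UNIV_if_delta:
  assumes V: "cg.csubspace V" and delta: "\<And>a. cg_delta a \<in> V"
  shows "V = UNIV"
proof -
  have "(\<lambda>g. if g \<in> A then x g else 0) \<in> V" for x A
  proof (induction A rule: finite_induct[OF finite])
    case (2 a A)
    have "(\<lambda>g. if g \<in> insert a A then x g else 0)
        = (\<lambda>g. x a * cg_delta a g + (if g \<in> A then x g else 0))"
      using 2 by (auto simp: cg_delta_def fun_eq_iff)
    then show ?case using 2 V delta by (simp add: cg.csubspace_def)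
  qed (use V in \<open>simp add: cg.csubspace_def\<close>)
  from this[of UNIV] show ?thesis by auto
qed

text \<open>The trace of \<open>cg_delta (inv g)\<close> times \<open>P\<close> is
  \<open>P g\<close>, so equal coefficients are zeros of the functionals in \<open>X\<close>. The
  spectral projections of all group elements supply the spanning set.\<close>

lemma ex_separating_projection_cg:
  assumes nonabelian: "\<exists>x y. x \<otimes> y \<noteq> y \<otimes> x"
  shows "\<exists>P. orth_proj G P \<and> (\<forall>g h k. g \<noteq> h \<longrightarrow> g \<otimes> k \<noteq> k \<otimes> g \<longrightarrow> P g \<noteq> P h)"
proof -
  let ?n = "card (UNIV :: 'g set)"
  have n: "1 < ?n"
  proof -
    obtain x y where "x \<otimes> y \<noteq> y \<otimes> x" using nonabelian by blast
    then have "x \<noteq> y" by auto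
    then have "card {x, y} \<le> ?n" by (intro card_mono) auto
    with \<open>x \<noteq> y\<close> show ?thesis by simp
  qed
  have "\<exists>Q. finite Q \<and> (\<forall>q\<in>Q. cg.projection q) \<and>
      (\<forall>V. cg.csubspace V \<longrightarrow> Q \<subseteq> V \<longrightarrow> cg_delta a \<in> V)" for a
    \<comment> \<open>By Lagrange the group order is a common exponent for all the unitaries
      \<open>cg_delta a\<close>.\<close>
    using pow_order_eq_1[of a] n
    by (intro cg.ex_projections_span_unitary[of _ ?n])
       (simp_all add: cg_star_delta cg_mult_delta_delta power_delta Coset.order_def carrier_UNIV cg_one_def[symmetric])
  then have "\<exists>Q. \<forall>a. finite (Q a) \<and> (\<forall>q\<in>Q a. cg.projection q) \<and>
      (\<forall>V. cg.csubspace V \<longrightarrow> Q a \<subseteq> V \<longrightarrow> cg_delta a \<in> V)"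
    by (intro choice allI)
  then obtain Q where Q: "\<And>a. finite (Q a)" "\<And>a. \<forall>q\<in>Q a. cg.projection q"
    "\<And>a V. cg.csubspace V \<Longrightarrow> Q a \<subseteq> V \<Longrightarrow> cg_delta a \<in> V"
    by blast
  define X where "X = range (\<lambda>(g, h) k. cg_delta (inv g) k - cg_delta (inv h) k)"
  have "cg.spanning (\<Union>a. Q a)"
    unfolding cg.spanning_def
  proof (intro allI impI csubspace_UNIV_if_delta)
    fix V a assume "cg.csubspace V" "(\<Union>a. Q a) \<subseteq> V"
    then show "cg_delta a \<in> V" by (intro Q(3)) auto
  qed
  then have "\<exists>P. cg.projection P \<and> (\<forall>x\<in>X. cg_mult G x P \<one> = 0 \<longrightarrow> (\<forall>b. cg.comm x b = (\<lambda>g. 0)))"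
    using Q(1,2) by (intro cg.ex_separating_projection[of "\<Union>a. Q a"]) (simp_all add: X_def)
  then obtain P where P: "cg.projection P"
    "\<And>x b. x \<in> X \<Longrightarrow> cg_mult G x P \<one> = 0 \<Longrightarrow> cg.comm x b = (\<lambda>g. 0)"
    by blast
  have "g \<otimes> k = k \<otimes> g" if gh: "g \<noteq> h" "P g = P h" for g h k
  proof -
    let ?x = "\<lambda>k. cg_delta (inv g) k - cg_delta (inv h) k"
    have "cg_mult G ?x P \<one> = 0"
      using gh(2) cg.left_diff_distrib[of "cg_delta (inv g)" "cg_delta (inv h)" P]
      by (simp add: cg_mult_delta_left)
    moreover have "?x \<in> X"
      unfolding X_def by (rule range_eqI[of _ _ "(g, h)"]) simp
    ultimately have "cg.comm ?x (cg_delta k) (inv g \<otimes> k) = 0"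
      using P(2) by simp
    moreover have "cg.comm ?x (cg_delta k) = (\<lambda>l. (cg_delta (inv g \<otimes> k) l - cg_delta (inv h \<otimes> k) l)
        - (cg_delta (k \<otimes> inv g) l - cg_delta (k \<otimes> inv h) l))"
      by (simp add: cg.comm_def cg.left_diff_distrib cg.right_diff_distrib cg_mult_delta_delta)
    moreover have "inv g \<otimes> k \<noteq> inv h \<otimes> k"
      using gh(1) by (metis in_carrier inv_inv right_cancel)
    \<comment> \<open>At \<open>inv g \<otimes> k\<close> the first term is 1 and the second is 0;
      the last enters with a plus sign, so only the term at \<open>k \<otimes> inv g\<close> can
      cancel the 1.\<close>
    ultimately have "inv g \<otimes> k = k \<otimes> inv g"
      by (auto simp: cg_delta_def split: if_splits)
    then show ?thesis
      by (metis in_carrier inv_solve_left inv_solve_right m_assoc)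
  qed
  then show ?thesis
    using P(1) by (intro exI[of _ P]) (auto simp: cg.projection_def orth_proj_def)
qed

end

section \<open>Ideals of the free algebra\<close>

definition fa_mono :: "'g gen list \<Rightarrow> 'g fa" where
  "fa_mono w = (\<lambda>v. if v = w then 1 else 0)"

lemma fa_mult_Nil: "fa_mult f k [] = f [] * k []"
  by (simp add: fa_mult_def)

text \<open>Peeling off the first letter gives the recursion behind the inductions on words.\<close>

lemma fa_mult_Cons: "fa_mult f k (x # w) = f [] * k (x # w) + fa_mult (\<lambda>v. f (x # v)) k w"
  unfolding fa_mult_def length_Cons sum.atMost_Suc_shift by simp

lemma fa_mult_add_left: "fa_mult (fa_add f g) k = fa_add (fa_mult f k) (fa_mult g k)"
  by (simp add: fa_mult_def fa_add_def distrib_right sum.distrib)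

lemma fa_mult_add_right: "fa_mult k (fa_add f g) = fa_add (fa_mult k f) (fa_mult k g)"
  by (simp add: fa_mult_def fa_add_def distrib_left sum.distrib)

lemma fa_mult_diff_left: "fa_mult (fa_diff f g) k = fa_diff (fa_mult f k) (fa_mult g k)"
  by (simp add: fa_mult_def fa_diff_def left_diff_distrib sum_subtractf)

lemma fa_mult_diff_right: "fa_mult k (fa_diff f g) = fa_diff (fa_mult k f) (fa_mult k g)"
  by (simp add: fa_mult_def fa_diff_def right_diff_distrib sum_subtractf)

lemma fa_mult_smul_left: "fa_mult (fa_smul c f) k = fa_smul c (fa_mult f k)"
  by (simp add: fa_mult_def fa_smul_def sum_distrib_left mult.assoc)

lemma fa_mult_smul_right: "fa_mult k (fa_smul c f) = fa_smul c (fa_mult k f)"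
  by (simp add: fa_mult_def fa_smul_def sum_distrib_left mult_ac)

lemma fa_mult_sum_right: "fa_mult k (fa_sum I F) = fa_sum I (\<lambda>i. fa_mult k (F i))"
  unfolding fa_mult_def fa_sum_def sum_distrib_left by (subst sum.swap) (rule refl)

lemma fa_mult_zero: "fa_mult (\<lambda>w. 0) k = (\<lambda>w. 0)" "fa_mult k (\<lambda>w. 0) = (\<lambda>w. 0)"
  by (simp_all add: fa_mult_def)

lemma fa_mult_assoc: "fa_mult (fa_mult f g) k = fa_mult f (fa_mult g k)"
proof
  fix w show "fa_mult (fa_mult f g) k w = fa_mult f (fa_mult g k) w"
  proof (induction w arbitrary: f)
    case (Cons x w)
    have "(\<lambda>v. fa_mult f g (x # v)) = fa_add (fa_smul (f []) (\<lambda>v. g (x # v))) (fa_mult (\<lambda>v. f (x # v)) g)"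
      by (simp add: fa_mult_Cons fa_add_def fa_smul_def)
    then show ?case
      by (simp add: fa_mult_Cons fa_mult_Nil fa_mult_add_left fa_mult_smul_left Cons.IH)
        (simp add: fa_add_def fa_smul_def fa_mult_Cons distrib_left Cons.IH)
  qed (simp add: fa_mult_Nil)
qed

lemma fa_mult_const_left: "fa_mult (fa_const c) f = fa_smul c f"
proof
  fix w show "fa_mult (fa_const c) f w = fa_smul c f w"
    by (cases w) (simp_all add: fa_mult_Nil fa_mult_Cons fa_const_def fa_smul_def fa_mult_zero)
qed

lemma fa_mult_const_right: "fa_mult f (fa_const c) = fa_smul c f"
proof
  fix w show "fa_mult f (fa_const c) w = fa_smul c f w"
    by (induction w arbitrary: f) (simp_all add: fa_mult_Nil fa_mult_Cons fa_const_def fa_smul_def)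
qed

lemma fa_smul_one: "fa_smul 1 f = f"
  by (simp add: fa_smul_def)

lemma fa_mono_Nil: "fa_mono [] = fa_const 1"
  by (simp add: fa_mono_def fa_const_def)

lemma fa_mono_single: "fa_mono [x] = fa_gen x"
  by (simp add: fa_mono_def fa_gen_def)

lemma fa_mono_Cons: "fa_mono (x # w) = fa_mult (fa_gen x) (fa_mono w)"
proof
  fix v show "fa_mono (x # w) v = fa_mult (fa_gen x) (fa_mono w) v"
  proof (cases v)
    case (Cons y v')
    have "(\<lambda>v. fa_gen x (y # v)) = fa_const (if y = x then 1 else 0)"
      by (auto simp: fa_gen_def fa_const_def)
    then show ?thesis using Cons
      by (simp add: fa_mult_Cons fa_mult_const_left) (simp add: fa_mono_def fa_gen_def fa_smul_def)
  qed (simp add: fa_mono_def fa_gen_def fa_mult_Nil)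
qed

lemma fa_mult_mono: "fa_mult (fa_mono v) (fa_mono w) = fa_mono (v @ w)"
  by (induction v)
    (simp_all add: fa_mono_Nil fa_mult_const_left fa_smul_one fa_mono_Cons fa_mult_assoc)

lemma fa_fin_zero: "fa_fin (\<lambda>w. 0)"
  by (simp add: fa_fin_def)

lemma fa_fin_add: "fa_fin f \<Longrightarrow> fa_fin k \<Longrightarrow> fa_fin (fa_add f k)"
  unfolding fa_fin_def fa_add_def
  by (rule finite_subset[of _ "{w. f w \<noteq> 0} \<union> {w. k w \<noteq> 0}"]) auto

lemma fa_fin_smul: "fa_fin f \<Longrightarrow> fa_fin (fa_smul c f)"
  unfolding fa_fin_def fa_smul_def by (rule finite_subset[of _ "{w. f w \<noteq> 0}"]) auto

lemma fa_diff_eq_add: "fa_diff f k = fa_add f (fa_smul (- 1) k)"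
  by (simp add: fa_diff_def fa_add_def fa_smul_def)

lemma fa_fin_diff: "fa_fin f \<Longrightarrow> fa_fin k \<Longrightarrow> fa_fin (fa_diff f k)"
  by (simp add: fa_diff_eq_add fa_fin_add fa_fin_smul)

lemma fa_fin_mono: "fa_fin (fa_mono w)"
  by (simp add: fa_fin_def fa_mono_def)

lemma fa_fin_gen: "fa_fin (fa_gen x)"
  by (simp flip: fa_mono_single add: fa_fin_mono)

lemma fa_const_eq_smul: "fa_const c = fa_smul c (fa_mono [])"
  by (simp add: fa_const_def fa_smul_def fa_mono_def fun_eq_iff)

lemma fa_fin_const: "fa_fin (fa_const c)"
  by (simp add: fa_const_eq_smul fa_fin_smul fa_fin_mono)

lemma fa_sum_empty: "fa_sum {} F = (\<lambda>w. 0)"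
  by (simp add: fa_sum_def)

lemma fa_sum_insert: "finite I \<Longrightarrow> i \<notin> I \<Longrightarrow> fa_sum (insert i I) F = fa_add (F i) (fa_sum I F)"
  by (simp add: fa_sum_def fa_add_def)

lemma fa_fin_sum: "finite I \<Longrightarrow> (\<And>i. i \<in> I \<Longrightarrow> fa_fin (F i)) \<Longrightarrow> fa_fin (fa_sum I F)"
  by (induction I rule: finite_induct) (simp_all add: fa_sum_empty fa_sum_insert fa_fin_zero fa_fin_add)

text \<open>Reduces linear statements to monomials.\<close>

lemma fa_fin_induct [consumes 1, case_names zero add]:
  assumes "fa_fin f"
    and zero: "P (\<lambda>w. 0)"
    and add: "\<And>c w f. fa_fin f \<Longrightarrow> P f \<Longrightarrow> P (fa_add (fa_smul c (fa_mono w)) f)"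
  shows "P f"
proof -
  have "finite A \<Longrightarrow> {w. f w \<noteq> 0} \<subseteq> A \<Longrightarrow> P f" for A
  proof (induction A arbitrary: f rule: finite_induct)
    case empty
    then have "f = (\<lambda>w. 0)" by auto
    with zero show ?case by simp
  next
    case (insert w A)
    let ?f = "f(w := 0)"
    have f: "f = fa_add (fa_smul (f w) (fa_mono w)) ?f"
      by (auto simp: fa_add_def fa_smul_def fa_mono_def)
    have sub: "{v. ?f v \<noteq> 0} \<subseteq> A" using insert.prems by auto
    then have "fa_fin ?f"
      unfolding fa_fin_def using insert.hyps(1) finite_subset by blast
    then show ?case by (subst f) (rule add[OF _ insert.IH[OF sub]])
  qed
  with assms(1) show ?thesis unfolding fa_fin_def by blast
qed

lemma fa_fin_mult: "fa_fin f \<Longrightarrow> fa_fin k \<Longrightarrow> fa_fin (fa_mult f k)"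
proof (induction f rule: fa_fin_induct)
  case (add c w f)
  have "fa_fin (fa_mult (fa_mono w) k)"
    using add.prems
  proof (induction k rule: fa_fin_induct)
    case (add d v k)
    then show ?case
      by (simp add: fa_mult_add_right fa_mult_smul_right fa_mult_mono fa_fin_add fa_fin_smul fa_fin_mono)
  qed (simp add: fa_mult_zero fa_fin_zero)
  with add show ?case
    by (simp add: fa_mult_add_left fa_mult_smul_left fa_fin_add fa_fin_smul)
qed (simp add: fa_mult_zero fa_fin_zero)

lemma gen_flip_gen_flip: "gen_flip (gen_flip x) = x"
  by (simp add: gen_flip_def split: prod.split)

lemma fa_star_mono: "fa_star (fa_mono w) = fa_mono (rev (map gen_flip w))"
proof -
  have "rev (map gen_flip v) = w \<longleftrightarrow> v = rev (map gen_flip w)" for v w :: "'a gen list"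
    by (auto simp: rev_map gen_flip_gen_flip o_def)
  then show ?thesis by (simp add: fa_star_def fa_mono_def fun_eq_iff)
qed

lemma fa_star_add: "fa_star (fa_add f k) = fa_add (fa_star f) (fa_star k)"
  by (simp add: fa_star_def fa_add_def)

lemma fa_star_smul: "fa_star (fa_smul c f) = fa_smul (cnj c) (fa_star f)"
  by (simp add: fa_star_def fa_smul_def)

lemma fa_star_zero: "fa_star (\<lambda>w. 0) = (\<lambda>w. 0)"
  by (simp add: fa_star_def)

lemma fa_star_star: "fa_star (fa_star f) = f"
  by (simp add: fa_star_def rev_map gen_flip_gen_flip o_def)

lemma fa_fin_star: "fa_fin f \<Longrightarrow> fa_fin (fa_star f)"
  by (induction f rule: fa_fin_induct)
    (simp_all add: fa_star_zero fa_fin_zero fa_star_add fa_star_smul fa_star_mono fa_fin_add fa_fin_smul fa_fin_mono)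

lemma fa_star_mult: "fa_star (fa_mult f k) = fa_mult (fa_star k) (fa_star f)"
proof
  fix w :: "'a gen list"
  let ?v = "map gen_flip w"
  have "fa_star (fa_mult f k) w = (\<Sum>i\<le>length w. cnj (f (take i (rev ?v))) * cnj (k (drop i (rev ?v))))"
    by (simp add: fa_star_def fa_mult_def)
  \<comment> \<open>Reversing the word turns a split after \<open>i\<close> letters into one after
    \<open>length w - i\<close> letters.\<close>
  also have "\<dots> = (\<Sum>i\<le>length w. fa_star k (take i w) * fa_star f (drop i w))"
    by (rule sum.reindex_bij_witness[of _ "\<lambda>i. length w - i" "\<lambda>i. length w - i"])
      (simp_all add: fa_star_def take_rev drop_rev take_map drop_map)
  finally show "fa_star (fa_mult f k) w = fa_mult (fa_star k) (fa_star f) w"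
    by (simp add: fa_mult_def)
qed

section \<open>Closure properties of the ideal and congruence modulo it\<close>

lemma fa_ideal_gen: "r \<in> R \<Longrightarrow> r \<in> fa_ideal R"
  using fa_ideal.gen[of r R "fa_const 1" "fa_const 1"]
  by (simp add: fa_fin_const fa_mult_const_left fa_mult_const_right fa_smul_one)

lemma fa_ideal_mult_left: "x \<in> fa_ideal R \<Longrightarrow> fa_fin k \<Longrightarrow> fa_mult k x \<in> fa_ideal R"
proof (induction rule: fa_ideal.induct)
  case (gen r a b)
  then show ?case
    using fa_ideal.gen[of r R "fa_mult k a" b] by (simp add: fa_mult_assoc fa_fin_mult)
next
  case (gen_star r a b)
  then show ?case
    using fa_ideal.gen_star[of r R "fa_mult k a" b] by (simp add: fa_mult_assoc fa_fin_mult)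
qed (simp_all add: fa_mult_zero fa_ideal.zero fa_mult_add_right fa_ideal.add)

lemma fa_ideal_mult_right: "x \<in> fa_ideal R \<Longrightarrow> fa_fin k \<Longrightarrow> fa_mult x k \<in> fa_ideal R"
proof (induction rule: fa_ideal.induct)
  case (gen r a b)
  then show ?case
    using fa_ideal.gen[of r R a "fa_mult b k"] by (simp add: fa_mult_assoc fa_fin_mult)
next
  case (gen_star r a b)
  then show ?case
    using fa_ideal.gen_star[of r R a "fa_mult b k"] by (simp add: fa_mult_assoc fa_fin_mult)
qed (simp_all add: fa_mult_zero fa_ideal.zero fa_mult_add_left fa_ideal.add)

text \<open>Scalars act as multiplication by constants.\<close>

lemma fa_ideal_smul: "x \<in> fa_ideal R \<Longrightarrow> fa_smul c x \<in> fa_ideal R"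
  using fa_ideal_mult_left[of x R "fa_const c"] by (simp add: fa_fin_const fa_mult_const_left)

text \<open>The star interchanges the rules \<open>gen\<close> and \<open>gen_star\<close>, swapping
  the outer factors.\<close>

lemma fa_ideal_star: "x \<in> fa_ideal R \<Longrightarrow> fa_star x \<in> fa_ideal R"
proof (induction rule: fa_ideal.induct)
  case (gen r a b)
  then show ?case
    using fa_ideal.gen_star[of r R "fa_star b" "fa_star a"]
    by (simp add: fa_star_mult fa_mult_assoc fa_fin_star)
next
  case (gen_star r a b)
  then show ?case
    using fa_ideal.gen[of r R "fa_star b" "fa_star a"]
    by (simp add: fa_star_mult fa_mult_assoc fa_fin_star fa_star_star)
qed (simp_all add: fa_star_zero fa_ideal.zero fa_star_add fa_ideal.add)

text \<open>Equality in the quotient algebra, in a form suited to calculational chains.\<close>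

definition fa_cong :: "'g fa set \<Rightarrow> 'g fa \<Rightarrow> 'g fa \<Rightarrow> bool" where
  "fa_cong R f k \<longleftrightarrow> fa_diff f k \<in> fa_ideal R"

lemma fa_cong_refl: "fa_cong R f f"
  using fa_ideal.zero[of R] by (simp add: fa_cong_def fa_diff_def)

lemma fa_cong_sym: "fa_cong R f k \<Longrightarrow> fa_cong R k f"
  using fa_ideal_smul[of "fa_diff f k" R "- 1"]
  by (simp add: fa_cong_def fa_diff_def fa_smul_def)

lemma fa_cong_trans [trans]: "fa_cong R f g \<Longrightarrow> fa_cong R g k \<Longrightarrow> fa_cong R f k"
  using fa_ideal.add[of "fa_diff f g" R "fa_diff g k"]
  by (simp add: fa_cong_def fa_diff_def fa_add_def)

lemma fa_cong_add: "fa_cong R f g \<Longrightarrow> fa_cong R f' g' \<Longrightarrow> fa_cong R (fa_add f f') (fa_add g g')"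
  using fa_ideal.add[of "fa_diff f g" R "fa_diff f' g'"]
  by (simp add: fa_cong_def fa_diff_def fa_add_def algebra_simps)

lemma fa_cong_smul: "fa_cong R f g \<Longrightarrow> fa_cong R (fa_smul c f) (fa_smul c g)"
  using fa_ideal_smul[of "fa_diff f g" R c]
  by (simp add: fa_cong_def fa_diff_def fa_smul_def right_diff_distrib)

lemma fa_cong_sum:
  "finite I \<Longrightarrow> (\<And>i. i \<in> I \<Longrightarrow> fa_cong R (F i) (H i)) \<Longrightarrow> fa_cong R (fa_sum I F) (fa_sum I H)"
  by (induction I rule: finite_induct) (simp_all add: fa_sum_empty fa_sum_insert fa_cong_refl fa_cong_add)

lemma fa_cong_mult_left: "fa_cong R f g \<Longrightarrow> fa_fin k \<Longrightarrow> fa_cong R (fa_mult k f) (fa_mult k g)"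
  using fa_ideal_mult_left[of "fa_diff f g" R k] by (simp add: fa_cong_def fa_mult_diff_right)

lemma fa_cong_mult_right: "fa_cong R f g \<Longrightarrow> fa_fin k \<Longrightarrow> fa_cong R (fa_mult f k) (fa_mult g k)"
  using fa_ideal_mult_right[of "fa_diff f g" R k] by (simp add: fa_cong_def fa_mult_diff_left)

lemma fa_cong_zero: "fa_cong R f (\<lambda>w. 0) \<longleftrightarrow> f \<in> fa_ideal R"
  by (simp add: fa_cong_def fa_diff_def)

lemma fa_cong_sum_single:
  assumes "finite I" "i \<in> I" "\<And>j. j \<in> I \<Longrightarrow> j \<noteq> i \<Longrightarrow> fa_cong R (F j) (\<lambda>w. 0)"
  shows "fa_cong R (fa_sum I F) (F i)"
proof -
  have "fa_cong R (fa_sum I F) (fa_sum I (\<lambda>j. if j = i then F i else (\<lambda>w. 0)))"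
    using assms by (intro fa_cong_sum) (auto simp: fa_cong_refl)
  also have "fa_sum I (\<lambda>j. if j = i then F i else (\<lambda>w. 0)) = F i"
    using assms(1,2) by (auto simp: fa_sum_def fun_eq_iff if_distribR)
  finally show ?thesis .
qed

section \<open>Evaluation and the kernel\<close>

context full_group
begin

lemma fa_eval_superset:
  assumes "finite S" "{w. f w \<noteq> 0} \<subseteq> S"
  shows "fa_eval G f g = (\<Sum>w\<in>S. f w * word_img G w g)"
  unfolding fa_eval_def by (rule sum.mono_neutral_left) (use assms in auto)

lemma fa_eval_zero: "fa_eval G (\<lambda>w. 0) = cg_zero"
  by (simp add: fa_eval_def cg_zero_def)

lemma fa_eval_add:
  assumes "fa_fin f" "fa_fin k"
  shows "fa_eval G (fa_add f k) = (\<lambda>g. fa_eval G f g + fa_eval G k g)"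
proof
  fix g
  let ?S = "{w. f w \<noteq> 0} \<union> {w. k w \<noteq> 0}"
  have S: "finite ?S" using assms by (simp add: fa_fin_def)
  show "fa_eval G (fa_add f k) g = fa_eval G f g + fa_eval G k g"
    by (subst (1 2 3) fa_eval_superset[OF S]) (auto simp: fa_add_def distrib_right sum.distrib)
qed

lemma fa_eval_smul: "fa_fin f \<Longrightarrow> fa_eval G (fa_smul c f) = (\<lambda>g. c * fa_eval G f g)"
proof
  fix g assume f: "fa_fin f"
  then have S: "finite {w. f w \<noteq> 0}" by (simp add: fa_fin_def)
  show "fa_eval G (fa_smul c f) g = c * fa_eval G f g"
    by (subst (1 2) fa_eval_superset[OF S]) (auto simp: fa_smul_def sum_distrib_left mult.assoc)
qed

lemma fa_eval_diff:
  assumes "fa_fin f" "fa_fin k"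
  shows "fa_eval G (fa_diff f k) = (\<lambda>g. fa_eval G f g - fa_eval G k g)"
  using assms by (simp add: fa_diff_eq_add fa_eval_add fa_eval_smul fa_fin_smul)

lemma fa_eval_mono: "fa_eval G (fa_mono w) = word_img G w"
proof -
  have "{v. fa_mono w v \<noteq> 0} = {w}" by (auto simp: fa_mono_def)
  then show ?thesis by (simp add: fa_eval_def fa_mono_def fun_eq_iff)
qed

lemma fa_eval_gen: "fa_eval G (fa_gen x) = gen_img G x"
  using fa_eval_mono[of "[x]"] by (simp add: fa_mono_single cg_mult_one_right)

lemma fa_eval_const: "fa_eval G (fa_const c) = (\<lambda>g. c * cg_one G g)"
  by (simp add: fa_const_eq_smul fa_eval_smul fa_fin_mono fa_eval_mono)

lemma fa_eval_sum:
  assumes "finite I" "\<And>i. i \<in> I \<Longrightarrow> fa_fin (F i)"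
  shows "fa_eval G (fa_sum I F) = (\<lambda>g. \<Sum>i\<in>I. fa_eval G (F i) g)"
  using assms
proof (induction I rule: finite_induct)
  case empty
  then show ?case by (simp add: fa_sum_empty fa_eval_zero cg_zero_def)
next
  case (insert i I)
  then show ?case by (simp add: fa_sum_insert fa_eval_add fa_fin_sum)
qed

lemma word_img_append: "word_img G (v @ w) = cg_mult G (word_img G v) (word_img G w)"
  by (induction v) (simp_all add: cg_mult_one_left cg_mult_assoc)

lemma cg_mult_zero: "cg_mult G cg_zero x = cg_zero" "cg_mult G x cg_zero = cg_zero"
  by (simp_all add: cg_mult_def cg_zero_def)

lemma fa_eval_mult: "fa_fin f \<Longrightarrow> fa_fin k \<Longrightarrow> fa_eval G (fa_mult f k) = cg_mult G (fa_eval G f) (fa_eval G k)"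
proof (induction f rule: fa_fin_induct)
  case (add c w f)
  have "fa_eval G (fa_mult (fa_mono w) k) = cg_mult G (word_img G w) (fa_eval G k)"
    using add.prems
  proof (induction k rule: fa_fin_induct)
    case (add d v k)
    then show ?case
      by (simp add: fa_mult_add_right fa_mult_smul_right fa_mult_mono fa_fin_mult fa_fin_smul fa_fin_mono
          fa_eval_add fa_eval_smul fa_eval_mono word_img_append cg_mult_linear)
  qed (simp add: fa_mult_zero fa_eval_zero cg_mult_zero)
  with add show ?case
    by (simp add: fa_mult_add_left fa_mult_smul_left fa_fin_mult fa_fin_smul fa_fin_mono
        fa_eval_add fa_eval_smul fa_eval_mono cg_mult_linear)
qed (simp add: fa_mult_zero fa_eval_zero cg_mult_zero)

lemma cg_star_zero: "cg_star G cg_zero = cg_zero"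
  by (simp add: cg_star_def cg_zero_def)

lemma gen_img_flip: "gen_img G (gen_flip x) = cg_star G (gen_img G x)"
  by (simp add: gen_img_def gen_flip_def split: prod.split)

lemma word_img_star: "word_img G (rev (map gen_flip w)) = cg_star G (word_img G w)"
  by (induction w)
    (simp_all add: cg_star_one word_img_append cg_star_mult gen_img_flip cg_mult_one_right)

lemma fa_eval_star: "fa_fin f \<Longrightarrow> fa_eval G (fa_star f) = cg_star G (fa_eval G f)"
  by (induction f rule: fa_fin_induct)
    (simp_all add: fa_star_zero fa_eval_zero cg_star_zero fa_star_add fa_star_smul fa_star_mono
      fa_eval_add fa_eval_smul fa_eval_mono word_img_star fa_fin_smul fa_fin_mono fa_fin_star cg_star_linear)

text \<open>Evaluation is a star-homomorphism on finitely supported elements, so it suffices that it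
  kills the generators.\<close>

lemma fa_ideal_subset_kernel:
  assumes R: "\<And>r. r \<in> R \<Longrightarrow> fa_fin r" "\<And>r. r \<in> R \<Longrightarrow> fa_eval G r = cg_zero"
    and x: "x \<in> fa_ideal R"
  shows "fa_fin x \<and> fa_eval G x = cg_zero"
  using x
  by (induction rule: fa_ideal.induct)
    (simp_all add: fa_fin_zero fa_eval_zero fa_fin_mult fa_fin_star fa_fin_add R fa_eval_mult fa_eval_add
      fa_eval_star cg_mult_zero cg_star_zero, simp add: cg_zero_def)

text \<open>The inversion in the antipode cancels the one in the trace pairing, leaving the
  coefficient of \<open>P\<close> itself as eigenvalue up to the group order.\<close>

lemma cg_conv_delta:
  "cg_conv G P (cg_delta h) k = (if k = h then of_nat (card (UNIV :: 'g set)) * P h else 0)"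
proof -
  have "cg_mult G (cg_antipode G P) (cg_delta k) \<one> = P k"
    using cg_mult_commute_one[of "cg_antipode G P" "cg_delta k"]
    by (simp add: cg_mult_delta_left cg_antipode_def)
  then show ?thesis
    by (auto simp: cg_conv_def cg_L_def cg_psi_def cg_delta_def)
qed

lemma delta_coef_apply: "delta_coef g h x = (if g = h \<and> x = h then 1 else 0)"
  by (simp add: delta_coef_def cg_delta_def cg_zero_def)

lemma gen_img_simps:
  "gen_img G (g, h, False) = delta_coef g h" "gen_img G (g, h, True) = cg_star G (delta_coef g h)"
  by (simp_all add: gen_img_def)

lemma delta_coef_mult:
  "cg_mult G (delta_coef c a) (delta_coef d b) = (if c = a \<and> d = b then cg_delta (a \<otimes> b) else cg_zero)"
  "cg_mult G (cg_star G (delta_coef k g)) (delta_coef k h) = (if k = g \<and> k = h then cg_one G else cg_zero)"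
  "cg_mult G (delta_coef g k) (cg_star G (delta_coef h k)) = (if k = g \<and> k = h then cg_one G else cg_zero)"
  by (auto simp: delta_coef_def cg_star_delta cg_star_zero cg_mult_zero cg_mult_delta_delta cg_one_def)

lemmas fa_fin_intros = fa_fin_diff fa_fin_sum fa_fin_mult fa_fin_smul fa_fin_gen fa_fin_const
lemmas fa_eval_simps = fa_eval_diff fa_eval_sum fa_eval_mult fa_eval_smul fa_eval_gen fa_eval_const

text \<open>The canonical surjection is well defined: the images of the \<open>u g h\<close> form a
  diagonal matrix of group elements.\<close>

lemma qut_relations_cg_conv:
  assumes "r \<in> qut_relations G (cg_conv G P)"
  shows "fa_fin r \<and> fa_eval G r = cg_zero"
  using assms unfolding qut_relations_def
proof (elim UnE CollectE exE conjE)
  fix g h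
  assume r: "r = fa_diff (fa_sum UNIV (\<lambda>k. fa_mult (ustar k g) (u k h))) (fa_const (if g = h then 1 else 0))"
  show ?thesis unfolding r
    by (cases "g = h") (auto simp: fa_fin_intros fa_eval_simps gen_img_simps delta_coef_mult cg_zero_def
        fun_eq_iff if_distribR cong: if_cong intro!: sum.neutral)
next
  fix g h
  assume r: "r = fa_diff (fa_sum UNIV (\<lambda>k. fa_mult (u g k) (ustar h k))) (fa_const (if g = h then 1 else 0))"
  show ?thesis unfolding r
    by (cases "g = h") (auto simp: fa_fin_intros fa_eval_simps gen_img_simps delta_coef_mult cg_zero_def
        fun_eq_iff if_distribR cong: if_cong intro!: sum.neutral)
next
  fix a b g
  assume r: "r = fa_diff
    (fa_sum UNIV (\<lambda>c. fa_sum UNIV (\<lambda>d. fa_smul (cg_mult G (cg_delta c) (cg_delta d) g) (fa_mult (u c a) (u d b)))))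
    (fa_sum UNIV (\<lambda>k. fa_smul (cg_mult G (cg_delta a) (cg_delta b) k) (u g k)))"
  have "(\<Sum>c\<in>UNIV. \<Sum>d\<in>UNIV. cg_delta (c \<otimes> d) g * (if c = a \<and> d = b then cg_delta (a \<otimes> b) else cg_zero) x)
      = cg_delta (a \<otimes> b) g * cg_delta (a \<otimes> b) x" for x
  proof -
    have "cg_delta (c \<otimes> d) g * (if c = a \<and> d = b then cg_delta (a \<otimes> b) else cg_zero) x
        = (if d = b then if c = a then cg_delta (a \<otimes> b) g * cg_delta (a \<otimes> b) x else 0 else 0)" for c d
      by (simp add: cg_zero_def)
    then show ?thesis by simp
  qed
  moreover have "(\<Sum>k\<in>UNIV. cg_delta (a \<otimes> b) k * delta_coef g k x) = cg_delta (a \<otimes> b) g * cg_delta (a \<otimes> b) x" for x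
    by (auto simp: cg_delta_def delta_coef_apply if_distrib[of "\<lambda>c. c * _"] cong: if_cong)
  ultimately show ?thesis unfolding r
    by (simp add: fa_fin_intros fa_eval_simps gen_img_simps delta_coef_mult cg_mult_delta_delta)
      (simp add: cg_zero_def)
next
  fix g
  assume r: "r = fa_diff (fa_sum UNIV (\<lambda>h. fa_smul (cg_one G h) (u g h))) (fa_const (cg_one G g))"
  have "(\<Sum>h\<in>UNIV. cg_one G h * delta_coef g h x) = cg_one G g * cg_one G x" for x
    by (auto simp: cg_one_def cg_delta_def delta_coef_apply if_distrib[of "\<lambda>c. c * _"] cong: if_cong)
  then show ?thesis unfolding r
    by (simp add: fa_fin_intros fa_eval_simps gen_img_simps cg_zero_def)
next
  fix g h
  let ?A = "cg_conv G P"
  assume r: "r = fa_diff (fa_sum UNIV (\<lambda>k. fa_smul (?A (cg_delta h) k) (u g k)))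
    (fa_sum UNIV (\<lambda>k. fa_smul (?A (cg_delta k) g) (u k h)))"
  \<comment> \<open>Both matrices are diagonal, so each sum has at most one nonzero term, and these
    agree.\<close>
  have "(\<Sum>k\<in>UNIV. ?A (cg_delta h) k * delta_coef g k x) = (\<Sum>k\<in>UNIV. ?A (cg_delta k) g * delta_coef k h x)" for x
    by (auto simp: cg_conv_delta delta_coef_apply if_distrib[of "\<lambda>c. c * _"] cong: if_cong)
  then show ?thesis unfolding r
    by (simp add: fa_fin_intros fa_eval_simps gen_img_simps cg_zero_def)
qed

text \<open>\<open>diag\<close> is the inverse of the canonical surjection, up to the ideal of relations.\<close>

definition diag :: "('g \<Rightarrow> complex) \<Rightarrow> 'g fa" where
  "diag x = fa_sum UNIV (\<lambda>g. fa_smul (x g) (u g g))"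

lemma fa_fin_diag: "fa_fin (diag x)"
  by (simp add: diag_def fa_fin_intros)

lemma diag_delta: "diag (cg_delta a) = u a a"
proof -
  have "(\<Sum>g\<in>UNIV. cg_delta a g * u g g w) = u a a w" for w
    by (simp add: cg_delta_def if_distrib[of "\<lambda>c. c * _"] cong: if_cong)
  then show ?thesis by (simp add: diag_def fa_sum_def fa_smul_def)
qed

lemma diag_zero: "diag cg_zero = (\<lambda>w. 0)"
  by (simp add: diag_def fa_sum_def fa_smul_def cg_zero_def)

lemma diag_linear: "diag (\<lambda>g. c * x g + y g) = fa_add (fa_smul c (diag x)) (diag y)"
  by (simp add: diag_def fa_sum_def fa_smul_def fa_add_def distrib_right sum.distrib sum_distrib_left mult.assoc)

section \<open>The quotient algebra for a separating \<open>P\<close>\<close>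

context
  fixes R :: "'g fa set" and P :: "'g \<Rightarrow> complex"
  assumes R: "R = qut_relations G (cg_conv G P)"
    and separating: "\<And>g h k. g \<noteq> h \<Longrightarrow> g \<otimes> k \<noteq> k \<otimes> g \<Longrightarrow> P g \<noteq> P h"
    and nonabelian: "\<exists>x y. x \<otimes> y \<noteq> y \<otimes> x"
begin

text \<open>As \<open>cg_conv G P\<close> is diagonal, the relation \<open>U A = A U\<close> at
  \<open>(g, h)\<close> is \<open>u g h\<close> times a multiple of \<open>P h - P g\<close>, which
  can be divided out.\<close>

lemma offdiagonal_if_neq: "P g \<noteq> P h \<Longrightarrow> fa_cong R (u g h) (\<lambda>w. 0)"
proof -
  assume neq: "P g \<noteq> P h"
  let ?A = "cg_conv G P" and ?n = "of_nat (card (UNIV :: 'g set)) :: complex"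
  let ?r = "fa_diff (fa_sum UNIV (\<lambda>k. fa_smul (?A (cg_delta h) k) (u g k)))
    (fa_sum UNIV (\<lambda>k. fa_smul (?A (cg_delta k) g) (u k h)))"
  have "?r \<in> R" unfolding R qut_relations_def by blast
  then have r: "?r \<in> fa_ideal R" by (rule fa_ideal_gen)
  have n: "?n \<noteq> 0" by simp
  have "?r = fa_smul (?n * (P h - P g)) (u g h)"
    by (simp add: fa_diff_def fa_sum_def fa_smul_def cg_conv_delta if_distrib[of "\<lambda>c. c * _"]
        cong: if_cong) (simp add: algebra_simps)
  then have eq: "fa_smul (1 / (?n * (P h - P g))) ?r = u g h"
    using neq n by (simp add: fa_smul_def)
  have "u g h \<in> fa_ideal R" unfolding eq[symmetric] by (rule fa_ideal_smul[OF r])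
  then show ?thesis by (simp add: fa_cong_zero)
qed

text \<open>With columns \<open>a\<close> and \<open>b\<close> diagonal, only the term
  \<open>(a, b)\<close> of the double sum in the multiplicativity relation survives. Column
  \<open>a \<otimes> b\<close> is then diagonal too.\<close>

lemma mult_relation:
  assumes "\<And>c. c \<noteq> a \<Longrightarrow> fa_cong R (u c a) (\<lambda>w. 0)" "\<And>d. d \<noteq> b \<Longrightarrow> fa_cong R (u d b) (\<lambda>w. 0)"
  shows "fa_cong R (u g (a \<otimes> b)) (if g = a \<otimes> b then fa_mult (u a a) (u b b) else (\<lambda>w. 0))"
proof -
  let ?F = "\<lambda>c d. fa_smul (cg_mult G (cg_delta c) (cg_delta d) g) (fa_mult (u c a) (u d b))"
  have F: "fa_cong R (?F c d) (\<lambda>w. 0)" if "c \<noteq> a \<or> d \<noteq> b" for c d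
  proof -
    have "fa_mult (u c a) (u d b) \<in> fa_ideal R"
      using that assms by (auto simp: fa_cong_zero fa_ideal_mult_left fa_ideal_mult_right fa_fin_gen)
    then show ?thesis by (simp add: fa_cong_zero fa_ideal_smul)
  qed
  have zero: "fa_sum UNIV (\<lambda>i :: 'g. (\<lambda>w. 0)) = (\<lambda>w :: 'g gen list. 0)"
    by (simp add: fa_sum_def)
  let ?r = "fa_diff (fa_sum UNIV (\<lambda>c. fa_sum UNIV (?F c)))
    (fa_sum UNIV (\<lambda>k. fa_smul (cg_mult G (cg_delta a) (cg_delta b) k) (u g k)))"
  have "?r \<in> R" unfolding R qut_relations_def by blast
  then have "fa_cong R (fa_sum UNIV (\<lambda>c. fa_sum UNIV (?F c)))
      (fa_sum UNIV (\<lambda>k. fa_smul (cg_mult G (cg_delta a) (cg_delta b) k) (u g k)))"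
    unfolding fa_cong_def by (rule fa_ideal_gen)
  also have "fa_sum UNIV (\<lambda>k. fa_smul (cg_mult G (cg_delta a) (cg_delta b) k) (u g k)) = u g (a \<otimes> b)"
    by (simp add: fa_sum_def fa_smul_def cg_mult_delta_delta)
      (simp add: cg_delta_def if_distrib[of "\<lambda>c. c * _"] cong: if_cong)
  finally have "fa_cong R (u g (a \<otimes> b)) (fa_sum UNIV (\<lambda>c. fa_sum UNIV (?F c)))"
    by (rule fa_cong_sym)
  also have "fa_cong R \<dots> (fa_sum UNIV (?F a))"
  proof (rule fa_cong_sum_single)
    fix c assume "c \<noteq> a"
    then have "fa_cong R (fa_sum UNIV (?F c)) (fa_sum UNIV (\<lambda>d :: 'g. (\<lambda>w. 0)))"
      by (intro fa_cong_sum F) simp_all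
    then show "fa_cong R (fa_sum UNIV (?F c)) (\<lambda>w. 0)" by (simp only: zero)
  qed simp_all
  also have "fa_cong R \<dots> (?F a b)"
    by (rule fa_cong_sum_single) (simp_all add: F)
  also have "?F a b = (if g = a \<otimes> b then fa_mult (u a a) (u b b) else (\<lambda>w. 0))"
    by (simp add: cg_mult_delta_delta fa_smul_def) (simp add: cg_delta_def)
  finally show ?thesis .
qed

text \<open>A central \<open>h\<close> is the product of two noncentral elements, so multiplicativity of \<open>U\<close> covers the
  columns that \<open>P\<close> need not separate.\<close>

lemma offdiagonal:
  assumes gh: "g \<noteq> h"
  shows "fa_cong R (u g h) (\<lambda>w. 0)"
proof (cases "\<exists>k. h \<otimes> k \<noteq> k \<otimes> h")
  case True
  then show ?thesis
    using separating[of h g] gh by (intro offdiagonal_if_neq) metis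
next
  case False
  then have h: "h \<otimes> k = k \<otimes> h" for k by blast
  obtain a k where a: "a \<otimes> k \<noteq> k \<otimes> a" using nonabelian by blast
  define b where "b = inv a \<otimes> h"
  have ab: "a \<otimes> b = h" by (simp add: b_def flip: m_assoc)
  \<comment> \<open>If \<open>b\<close> commuted with \<open>k\<close>, so would \<open>a\<close>,
    because \<open>a \<otimes> b = h\<close> is central.\<close>
  have b: "b \<otimes> k \<noteq> k \<otimes> b"
  proof
    assume "b \<otimes> k = k \<otimes> b"
    have "a \<otimes> k \<otimes> b = k \<otimes> a \<otimes> b"
      using h[of k] ab \<open>b \<otimes> k = k \<otimes> b\<close> by (metis in_carrier m_assoc)
    with a show False by (simp add: right_cancel)
  qed
  have "fa_cong R (u c a) (\<lambda>w. 0)" if "c \<noteq> a" for c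
    using separating[of a c k] a that by (intro offdiagonal_if_neq) metis
  moreover have "fa_cong R (u d b) (\<lambda>w. 0)" if "d \<noteq> b" for d
    using separating[of b d k] b that by (intro offdiagonal_if_neq) metis
  ultimately show ?thesis
    using mult_relation[of a b g] gh by (simp add: ab)
qed

lemma diagonal_mult: "fa_cong R (fa_mult (u a a) (u b b)) (u (a \<otimes> b) (a \<otimes> b))"
  using mult_relation[OF offdiagonal offdiagonal, of a b "a \<otimes> b"] by (simp add: fa_cong_sym)

lemma diagonal_one: "fa_cong R (u \<one> \<one>) (fa_const 1)"
proof -
  let ?r = "fa_diff (fa_sum UNIV (\<lambda>h. fa_smul (cg_one G h) (u \<one> h))) (fa_const (cg_one G \<one>))"
  have "?r \<in> R" unfolding R qut_relations_def by blast
  then have "?r \<in> fa_ideal R" by (rule fa_ideal_gen)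
  moreover have "fa_sum UNIV (\<lambda>h. fa_smul (cg_one G h) (u \<one> h)) = u \<one> \<one>"
    by (simp add: fa_sum_def fa_smul_def cg_one_def cg_delta_def if_distrib[of "\<lambda>c. c * _"] cong: if_cong)
  ultimately show ?thesis by (simp add: fa_cong_def cg_one_def cg_delta_def)
qed

text \<open>In the quotient \<open>ustar g g\<close> is a left inverse of \<open>u g g\<close>, and
  the diagonal entry at \<open>inv g\<close> is a right inverse, so they agree.\<close>

lemma diagonal_star: "fa_cong R (ustar g g) (u (inv g) (inv g))"
proof -
  let ?g = "inv g"
  let ?r = "fa_diff (fa_sum UNIV (\<lambda>k. fa_mult (ustar k g) (u k g))) (fa_const (if g = g then 1 else 0))"
  have "?r \<in> R" unfolding R qut_relations_def by blast
  then have "?r \<in> fa_ideal R" by (rule fa_ideal_gen)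
  then have 1: "fa_cong R (fa_sum UNIV (\<lambda>k. fa_mult (ustar k g) (u k g))) (fa_const 1)"
    by (simp add: fa_cong_def)
  have "fa_cong R (fa_sum UNIV (\<lambda>k. fa_mult (ustar k g) (u k g))) (fa_mult (ustar g g) (u g g))"
    using offdiagonal by (intro fa_cong_sum_single) (auto simp: fa_cong_zero fa_ideal_mult_left fa_fin_gen)
  then have 2: "fa_cong R (fa_mult (ustar g g) (u g g)) (fa_const 1)"
    using 1 fa_cong_sym fa_cong_trans by blast
  have "fa_cong R (fa_mult (u g g) (u ?g ?g)) (fa_const 1)"
    using diagonal_mult[of g ?g] diagonal_one by (auto intro: fa_cong_trans)
  then have "fa_cong R (fa_mult (ustar g g) (fa_mult (u g g) (u ?g ?g))) (fa_mult (ustar g g) (fa_const 1))"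
    by (rule fa_cong_mult_left) (rule fa_fin_gen)
  then have 3: "fa_cong R (fa_mult (fa_mult (ustar g g) (u g g)) (u ?g ?g)) (ustar g g)"
    by (simp add: fa_mult_assoc fa_mult_const_right fa_smul_one)
  have "fa_cong R (fa_mult (fa_mult (ustar g g) (u g g)) (u ?g ?g)) (fa_mult (fa_const 1) (u ?g ?g))"
    by (rule fa_cong_mult_right[OF 2 fa_fin_gen])
  with 3 show ?thesis
    by (simp add: fa_mult_const_left fa_smul_one) (blast intro: fa_cong_sym fa_cong_trans)
qed

lemma gen_cong_diag: "fa_cong R (fa_gen x) (diag (gen_img G x))"
proof -
  obtain g h b where x: "x = (g, h, b)" by (cases x)
  show ?thesis
  proof (cases "g = h")
    case True
    then show ?thesis
      using diagonal_star[of h]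
      by (cases b) (simp_all add: x gen_img_def delta_coef_def cg_star_delta diag_delta fa_cong_refl)
  next
    case False
    have star: "fa_star (u g h) = ustar g h"
      using fa_star_mono[of "[(g, h, False)]"] by (simp add: fa_mono_single gen_flip_def)
    have "u g h \<in> fa_ideal R" using offdiagonal[OF False] by (simp add: fa_cong_zero)
    moreover from fa_ideal_star[OF this] have "ustar g h \<in> fa_ideal R" by (simp only: star)
    ultimately show ?thesis
      using False by (cases b) (simp_all add: x gen_img_def delta_coef_def cg_star_zero diag_zero fa_cong_zero)
  qed
qed

text \<open>Left multiplication by \<open>u a a\<close> permutes the diagonal generators by left
  translation.\<close>

lemma diag_delta_mult: "fa_cong R (fa_mult (u a a) (diag y)) (diag (cg_mult G (cg_delta a) y))"
proof -
  have eq: "fa_mult (u a a) (diag y) = fa_sum UNIV (\<lambda>g. fa_smul (y g) (fa_mult (u a a) (u g g)))"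
    by (simp add: diag_def fa_mult_sum_right fa_mult_smul_right)
  have "fa_cong R (fa_mult (u a a) (diag y)) (fa_sum UNIV (\<lambda>g. fa_smul (y g) (u (a \<otimes> g) (a \<otimes> g))))"
    unfolding eq by (intro fa_cong_sum fa_cong_smul diagonal_mult) simp
  also have "fa_sum UNIV (\<lambda>g. fa_smul (y g) (u (a \<otimes> g) (a \<otimes> g))) = diag (cg_mult G (cg_delta a) y)"
  proof -
    have "(\<Sum>g\<in>UNIV. y (inv a \<otimes> g) * u g g w) = (\<Sum>g\<in>UNIV. y (inv a \<otimes> (a \<otimes> g)) * u (a \<otimes> g) (a \<otimes> g) w)" for w
      by (rule sum_translate[symmetric])
    then show ?thesis
      by (simp add: diag_def fa_sum_def fa_smul_def cg_mult_delta_left flip: m_assoc)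
  qed
  finally show ?thesis .
qed

text \<open>Letters evaluate to group elements or zero, so \<open>diag_delta_mult\<close> covers
  every product met in \<open>mono_cong_diag\<close>.\<close>

lemma gen_img_cases: "(\<exists>a. gen_img G x = cg_delta a) \<or> gen_img G x = cg_zero"
  by (auto simp: gen_img_def delta_coef_def cg_star_delta cg_star_zero split: prod.split)

lemma mono_cong_diag: "fa_cong R (fa_mono w) (diag (word_img G w))"
proof (induction w)
  case Nil
  then show ?case
    using diagonal_one by (simp add: fa_mono_Nil cg_one_def diag_delta fa_cong_sym)
next
  case (Cons x w)
  have "fa_cong R (fa_mult (fa_gen x) (fa_mono w)) (fa_mult (fa_gen x) (diag (word_img G w)))"
    by (rule fa_cong_mult_left[OF Cons.IH fa_fin_gen])
  also have "fa_cong R \<dots> (fa_mult (diag (gen_img G x)) (diag (word_img G w)))"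
    by (rule fa_cong_mult_right[OF gen_cong_diag fa_fin_diag])
  also have "fa_cong R \<dots> (diag (cg_mult G (gen_img G x) (word_img G w)))"
    using gen_img_cases[of x] diag_delta_mult
    by (auto simp: diag_delta diag_zero fa_mult_zero cg_mult_zero fa_cong_refl)
  finally show ?case by (simp add: fa_mono_Cons)
qed

text \<open>Evaluation followed by \<open>diag\<close> is the identity on the quotient, so an
  element with value zero lies in the ideal.\<close>

lemma cong_diag_eval: "fa_fin f \<Longrightarrow> fa_cong R f (diag (fa_eval G f))"
proof (induction f rule: fa_fin_induct)
  case zero
  then show ?case by (simp add: fa_eval_zero diag_zero fa_cong_refl)
next
  case (add c w f)
  then show ?case
    by (simp add: fa_eval_add fa_eval_smul fa_eval_mono fa_fin_smul fa_fin_mono diag_linear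
        fa_cong_add fa_cong_smul mono_cong_diag)
qed

lemma qut_is_G_if_separating: "qut_is_G G (cg_conv G P)"
proof -
  have "f \<in> fa_ideal R" if "fa_fin f" "fa_eval G f = cg_zero" for f
    using cong_diag_eval[OF that(1)] that(2) by (simp add: diag_zero fa_cong_zero)
  moreover have "fa_fin f \<and> fa_eval G f = cg_zero" if "f \<in> fa_ideal R" for f
    using fa_ideal_subset_kernel[OF _ _ that] qut_relations_cg_conv unfolding R by blast
  ultimately show ?thesis unfolding qut_is_G_def R[symmetric] by blast
qed

end

end

theorem theorem6p3:
  fixes G :: "('g::finite, 'm) monoid_scheme"
  assumes "group G"
    and "carrier G = UNIV"
    and "\<exists>x y. x \<otimes>\<^bsub>G\<^esub> y \<noteq> y \<otimes>\<^bsub>G\<^esub> x"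
  shows "\<exists>P. orth_proj G P \<and> qut_is_G G (cg_conv G P)"
proof -
  interpret full_group G
    using assms(1,2) by (simp add: full_group_def full_group_axioms_def)
  obtain P where "orth_proj G P" "\<And>g h k. g \<noteq> h \<Longrightarrow> g \<otimes>\<^bsub>G\<^esub> k \<noteq> k \<otimes>\<^bsub>G\<^esub> g \<Longrightarrow> P g \<noteq> P h"
    using ex_separating_projection_cg[OF assms(3)] by blast
  with qut_is_G_if_separating[OF refl _ assms(3)] show ?thesis by blast
qed

end
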